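(* Let $m, r$ and $d$ be integers such that $d \geq 1$ and $2 \leq 2r \leq m-1$. Define the following subset of $\mathrm{POL}^{ss}_{d,2r,m}$: $$ \mathcal{G}^{ss}_{d,2r,m} := \left\{ U(\lambda) V(\lambda)^T - V(\lambda) U(\lambda)^T \; : \; V(\lambda) \in \mathrm{POL}^{m\times r}_{\lceil d/2 \rceil},\; U(\lambda) \in \mathrm{POL}^{m\times r}_{\lfloor d/2 \rfloor} \right\}. $$ Then $$ \overline{\mathcal{G}^{ss}_{d,2r,m}} = \mathrm{POL}^{ss}_{d,2r,m}. $$
   Context: All matrix polynomials have coefficients in $\mathbb{C}$. A matrix polynomial has grade $d$ if it is of the form $P(\lambda)=\sum_{i=0}^d \lambda^i A_i$, i.e. its degree is at most $d$ (the zero polynomial is allowed). $\mathrm{POL}^{p\times q}_{d}$ is the vector space of $p\times q$ matrix polynomials of grade $d$. $\mathrm{POL}^{ss}_{d,m}$ is the vector space of $m\times m$ skew-symmetric matrix polynomials of grade $d$, i.e. $P(\lambda)=\sum_{i=0}^d\lambda^i A_i$ with $A_i\in\mathbb{C}^{m\times m}$, $A_i^T=-A_i$. The (normal) rank of a matrix polynomial is its rank as a matrix over the field of rational functions $\mathbb{C}(\lambda)$. $\mathrm{POL}^{ss}_{d,2r,m}$ is the set of $P\in \mathrm{POL}^{ss}_{d,m}$ with normal rank at most $2r$. $\mathrm{POL}^{ss}_{d,m}$ is a metric space with distance $d(P,P')=\left(\sum_{i=0}^d\|A_i-A_i'\|_F^2\right)^{1/2}$ for $P=\sum_{i=0}^d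 \lambda^iA_i$, $P'=\sum_{i=0}^d \lambda^iA_i'$, and $\overline{\mathcal{S}}$ denotes the closure of a subset $\mathcal{S}$ in the resulting (Euclidean) topology. *)

theory Defs
  imports
    "HOL-Analysis.Analysis"
    "HOL-Computational_Algebra.Polynomial_Factorial"
    "Jordan_Normal_Form.DL_Rank"
begin

text \<open>A matrix polynomial is represented as a matrix with polynomial entries; its coefficient
  matrices \<open>A\<^sub>k\<close> are recovered by \<open>coeff_mat\<close>.\<close>

definition coeff_mat :: "complex poly mat \<Rightarrow> nat \<Rightarrow> complex mat" where
  "coeff_mat P k = map_mat (\<lambda>p. coeff p k) P"

definition POL :: "nat \<Rightarrow> nat \<Rightarrow> nat \<Rightarrow> complex poly mat set" where
  "POL p q d = {P \<in> carrier_mat p q. \<forall>i<p. \<forall>j<q. degree (P $$ (i, j)) \<le> d}"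

definition POL_ss :: "nat \<Rightarrow> nat \<Rightarrow> complex poly mat set" where
  "POL_ss d m = {P \<in> POL m m d. \<forall>k\<le>d. transpose_mat (coeff_mat P k) = - coeff_mat P k}"

text \<open>\<open>complex poly fract\<close> is the field of rational functions.\<close>

definition normal_rank :: "complex poly mat \<Rightarrow> nat" where
  "normal_rank P = vec_space.rank (dim_row P) (map_mat to_fract P)"

text \<open>The second argument of \<open>POL_ss_rank\<close> is the rank bound itself.\<close>

definition POL_ss_rank :: "nat \<Rightarrow> nat \<Rightarrow> nat \<Rightarrow> complex poly mat set" where
  "POL_ss_rank d s m = {P \<in> POL_ss d m. normal_rank P \<le> s}"

text \<open>The squared Frobenius norms of \<open>A\<^sub>k - A'\<^sub>k\<close> are written out entrywise:
  \<open>Metric_space\<close> demands a distance that is symmetric also off the carrier, whereas subtraction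
  of matrices of different dimensions is not. On the carrier see \<open>pol_dist_frob_norm\<close>.\<close>

definition pol_dist :: "nat \<Rightarrow> nat \<Rightarrow> complex poly mat \<Rightarrow> complex poly mat \<Rightarrow> real" where
  "pol_dist d m P P' = sqrt (\<Sum>k\<le>d. \<Sum>i<m. \<Sum>j<m.
     (cmod (coeff_mat P k $$ (i, j) - coeff_mat P' k $$ (i, j)))\<^sup>2)"

definition frob_norm :: "complex mat \<Rightarrow> real" where
  "frob_norm A = sqrt (\<Sum>i<dim_row A. \<Sum>j<dim_col A. (cmod (A $$ (i, j)))\<^sup>2)"

definition POL_ss_topology :: "nat \<Rightarrow> nat \<Rightarrow> complex poly mat topology" where
  "POL_ss_topology d m = Metric_space.mtopology (POL_ss d m) (pol_dist d m)"

definition G_ss :: "nat \<Rightarrow> nat \<Rightarrow> nat \<Rightarrow> complex poly mat set" where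
  "G_ss d r m = {U * transpose_mat V - V * transpose_mat U | U V.
     V \<in> POL m r (nat \<lceil>real d / 2\<rceil>) \<and> U \<in> POL m r (nat \<lfloor>real d / 2\<rfloor>)}"

lemma pol_dist_frob_norm:
  assumes "P \<in> carrier_mat m m" "P' \<in> carrier_mat m m"
  shows "pol_dist d m P P' = sqrt (\<Sum>k\<le>d. (frob_norm (coeff_mat P k - coeff_mat P' k))\<^sup>2)"
  using assms by (simp add: pol_dist_def frob_norm_def coeff_mat_def sum_nonneg)

lemma pol_dist_L2_set:
  "pol_dist d m P P' = L2_set (\<lambda>(k, i, j).
     cmod (coeff_mat P k $$ (i, j) - coeff_mat P' k $$ (i, j))) ({..d} \<times> {..<m} \<times> {..<m})"
  by (simp add: pol_dist_def L2_set_def sum.cartesian_product case_prod_unfold)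

lemma Metric_space_POL_ss: "Metric_space (POL_ss d m) (pol_dist d m)"
proof
  fix P Q :: "complex poly mat"
  show "0 \<le> pol_dist d m P Q"
    by (simp add: pol_dist_L2_set)
  show "pol_dist d m P Q = pol_dist d m Q P"
    by (simp add: pol_dist_def norm_minus_commute)
next
  fix P Q assume P: "P \<in> POL_ss d m" and Q: "Q \<in> POL_ss d m"
  have car: "P \<in> carrier_mat m m" "Q \<in> carrier_mat m m"
    using P Q by (auto simp: POL_ss_def POL_def)
  show "pol_dist d m P Q = 0 \<longleftrightarrow> P = Q"
  proof
    assume "pol_dist d m P Q = 0"
    then have *: "\<forall>x\<in>{..d} \<times> {..<m} \<times> {..<m}. (\<lambda>(k, i, j).
        cmod (coeff_mat P k $$ (i, j) - coeff_mat Q k $$ (i, j))) x = 0"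
      unfolding pol_dist_L2_set by (subst (asm) L2_set_eq_0_iff) auto
    show "P = Q"
    proof (rule eq_matI)
      fix i j assume ij: "i < dim_row Q" "j < dim_col Q"
      then have ij': "i < m" "j < m" using car by auto
      show "P $$ (i, j) = Q $$ (i, j)"
      proof (rule poly_eqI)
        fix k
        show "coeff (P $$ (i, j)) k = coeff (Q $$ (i, j)) k"
        proof (cases "k \<le> d")
          case True
          then show ?thesis
            using bspec[OF *, of "(k, i, j)"] ij' car by (simp add: coeff_mat_def)
        next
          case False
          moreover have "degree (P $$ (i, j)) \<le> d" "degree (Q $$ (i, j)) \<le> d"
            using P Q ij' by (auto simp: POL_ss_def POL_def)
          ultimately show ?thesis by (simp add: coeff_eq_0)
        qed
      qed
    qed (use car in auto)
  qed (simp add: pol_dist_def)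
next
  fix P Q R :: "complex poly mat"
  let ?S = "{..d} \<times> {..<m} \<times> {..<m}"
  let ?f = "\<lambda>P Q (k, i, j). cmod (coeff_mat P k $$ (i, j) - coeff_mat Q k $$ (i, j))"
  have "L2_set (?f P R) ?S \<le> L2_set (\<lambda>x. ?f P Q x + ?f Q R x) ?S"
    by (rule L2_set_mono) (auto intro: norm_diff_triangle_le)
  also have "\<dots> \<le> L2_set (?f P Q) ?S + L2_set (?f Q R) ?S"
    by (rule L2_set_triangle_ineq)
  finally show "pol_dist d m P R \<le> pol_dist d m P Q + pol_dist d m Q R"
    by (simp only: pol_dist_L2_set)
qed

lemma G_ss_subset_POL_ss: "G_ss d r m \<subseteq> POL_ss d m"
proof
  fix P assume "P \<in> G_ss d r m"
  then obtain U V where P: "P = U * transpose_mat V - V * transpose_mat U"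
    and V: "V \<in> POL m r (nat \<lceil>real d / 2\<rceil>)" and U: "U \<in> POL m r (nat \<lfloor>real d / 2\<rfloor>)"
    unfolding G_ss_def by blast
  have car: "U \<in> carrier_mat m r" "V \<in> carrier_mat m r"
    using U V by (auto simp: POL_def)
  have half: "nat \<lfloor>real d / 2\<rfloor> + nat \<lceil>real d / 2\<rceil> = d"
    by linarith
  have entry: "P $$ (i, j) = (\<Sum>l<r. U $$ (i, l) * V $$ (j, l) - V $$ (i, l) * U $$ (j, l))"
    if "i < m" "j < m" for i j
    using that car by (simp add: P scalar_prod_def sum_subtractf lessThan_atLeast0)
  have "degree (P $$ (i, j)) \<le> d" if ij: "i < m" "j < m" for i j
    unfolding entry[OF ij]
  proof (rule degree_sum_le)
    fix l assume "l \<in> {..<r}"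
    then have l: "l < r" by simp
    have dU: "degree (U $$ (a, l)) \<le> nat \<lfloor>real d / 2\<rfloor>"
      and dV: "degree (V $$ (a, l)) \<le> nat \<lceil>real d / 2\<rceil>" if "a < m" for a
      using U V that l by (auto simp: POL_def)
    have "degree (U $$ (i, l) * V $$ (j, l)) \<le> d" "degree (V $$ (i, l) * U $$ (j, l)) \<le> d"
      using degree_mult_le[of "U $$ (i, l)" "V $$ (j, l)"] dU[OF ij(1)] dV[OF ij(2)]
        degree_mult_le[of "V $$ (i, l)" "U $$ (j, l)"] dV[OF ij(1)] dU[OF ij(2)] half by linarith+
    then show "degree (U $$ (i, l) * V $$ (j, l) - V $$ (i, l) * U $$ (j, l)) \<le> d"
      by (rule degree_diff_le)
  qed simp
  moreover have Pc: "P \<in> carrier_mat m m"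
    using car by (auto simp: P)
  moreover have skew: "P $$ (j, i) = - P $$ (i, j)" if "i < m" "j < m" for i j
    using that by (simp add: entry sum_negf[symmetric] algebra_simps)
  have "transpose_mat (coeff_mat P k) = - coeff_mat P k" for k
  proof (rule eq_matI)
    fix i j assume "i < dim_row (- coeff_mat P k)" "j < dim_col (- coeff_mat P k)"
    then have ij: "i < m" "j < m" using Pc by (auto simp: coeff_mat_def)
    show "transpose_mat (coeff_mat P k) $$ (i, j) = (- coeff_mat P k) $$ (i, j)"
      using ij Pc arg_cong[OF skew[OF ij], of "\<lambda>p. coeff p k"] by (simp add: coeff_mat_def)
  qed (use Pc in \<open>auto simp: coeff_mat_def\<close>)
  ultimately show "P \<in> POL_ss d m"
    by (simp add: POL_ss_def POL_def)
qed

end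

theory Submission
  imports Defs "HOL-Computational_Algebra.Fundamental_Theorem_Algebra"
begin

text \<open>
  Write \<open>u \<and> v\<close> for the skew-symmetric matrix \<open>u v\<^sup>T - v u\<^sup>T\<close>. Elimination over the polynomials turns a
  skew-symmetric \<open>P\<close> of normal rank at most \<open>2r\<close> into \<open>q P = \<Sum> u\<^sub>l \<and> v\<^sub>l\<close> with \<open>r\<close> terms and a scalar
  \<open>q \<noteq> 0\<close>. At a root of \<open>q\<close> the sum vanishes, so symplectic shears make every \<open>u\<^sub>l\<close> vanish there and
  the linear factor can be cancelled; hence \<open>P = \<Sum> u\<^sub>l \<and> v\<^sub>l\<close>. The same argument at infinity lowers the
  common value of \<open>deg u\<^sub>l + deg v\<^sub>l\<close> until it is at most \<open>d\<close>. Each pair is then balanced separately: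
  if \<open>deg u = p\<close>, \<open>deg v = q > p\<close> and \<open>w\<close> is the coefficient of \<open>v\<close> at \<open>\<lambda>\<^sup>q\<close>, then
  \<open>u' = u + \<epsilon> \<lambda>\<^bsup>p+1\<^esup> w\<close> and \<open>v' = v - \<epsilon>\<^sup>-\<^sup>1 \<lambda>\<^bsup>q-p-1\<^esup> u'\<close> have degrees \<open>p + 1\<close> and \<open>q - 1\<close>, and
  \<open>u' \<and> v' = u' \<and> v\<close> tends to \<open>u \<and> v\<close>. Conversely, one elimination step lowers the rank by exactly two and is
  continuous, so by induction the rank bound passes to limits.
\<close>

section \<open>Sums of elementary bivectors\<close>

hide_const (open) Module.smult

text \<open>Vectors are functions on all of \<open>nat\<close>, so identities between bivectors need
  no dimension bounds.\<close>

definition wedge_sum :: "'i set \<Rightarrow> ('i \<Rightarrow> nat \<Rightarrow> 'a::comm_ring) \<Rightarrow> ('i \<Rightarrow> nat \<Rightarrow> 'a) \<Rightarrow> nat \<Rightarrow> nat \<Rightarrow> 'a"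
  where "wedge_sum I u v i j = (\<Sum>l\<in>I. u l i * v l j - v l i * u l j)"

lemma wedge_sum_empty [simp]: "wedge_sum {} u v i j = 0"
  by (simp add: wedge_sum_def)

lemma wedge_sum_insert:
  "finite I \<Longrightarrow> p \<notin> I \<Longrightarrow>
    wedge_sum (insert p I) u v i j = wedge_sum I u v i j + (u p i * v p j - v p i * u p j)"
  by (simp add: wedge_sum_def add.commute)

lemma wedge_sum_cong:
  assumes "\<And>l. l \<in> I \<Longrightarrow> u l = u' l" "\<And>l. l \<in> I \<Longrightarrow> v l = v' l"
  shows "wedge_sum I u v = wedge_sum I u' v'"
  using assms by (auto simp: wedge_sum_def fun_eq_iff intro!: sum.cong)

text \<open>Invariance under a symplectic shear: subtracting multiples of \<open>w\<close> leaves
  only cross terms containing \<open>w\<close>, which the partner of \<open>w\<close> absorbs. The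
  multiple \<open>h\<close> is free because \<open>w\<close> wedged with itself vanishes.\<close>

lemma wedge_sum_shear:
  fixes w z :: "nat \<Rightarrow> 'a::comm_ring" and u v :: "'i \<Rightarrow> nat \<Rightarrow> 'a" and f g :: "'i \<Rightarrow> 'a" and h :: 'a
  assumes "finite S"
  defines "z' \<equiv> \<lambda>i. z i - h * w i + (\<Sum>l\<in>S. g l * v l i - f l * u l i)"
  shows "wedge_sum S (\<lambda>l i. u l i - g l * w i) (\<lambda>l i. v l i - f l * w i) i j + (w i * z' j - z' i * w j)
    = wedge_sum S u v i j + (w i * z j - z i * w j)"
  unfolding z'_def using assms(1)
proof (induction S rule: finite_induct)
  case empty
  show ?case by (simp add: algebra_simps)
next
  case (insert x S)
  then show ?case by (simp add: wedge_sum_insert algebra_simps)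
qed

text \<open>The maps \<open>e k\<close> stand either for evaluation at a fixed point (with \<open>t = 1\<close> and trivial \<open>A\<close>) or for
  the coefficient at \<open>\<lambda>\<^sup>k\<close> (with \<open>t n = \<lambda>\<^sup>n\<close> and \<open>A k\<close> the polynomials of degree at most \<open>k\<close>), that is, for
  evaluation at infinity. Treating the pairs by decreasing \<open>b\<close> keeps all exponents of \<open>t\<close> nonnegative:
  if \<open>x\<close> is a nonzero coordinate of \<open>e u\<^sub>p\<close>, the corresponding row of the hypothesis expresses \<open>e v\<^sub>p\<close> through
  the other vectors, and the symplectic shear that removes it from \<open>v\<^sub>p\<close> respects all degree bounds.\<close>

lemma pivot_elimination:
  fixes e :: "nat \<Rightarrow> complex poly \<Rightarrow> complex" and t :: "nat \<Rightarrow> complex poly"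
    and A :: "nat \<Rightarrow> complex poly set" and u v :: "'i \<Rightarrow> nat \<Rightarrow> complex poly"
  assumes e_add: "\<And>k p q. e k (p + q) = e k p + e k q"
    and e_smult: "\<And>k c p. e k (smult c p) = c * e k p"
    and e_shift: "\<And>k n p. e (n + k) (t n * p) = e k p"
    and A_add: "\<And>k p q. p \<in> A k \<Longrightarrow> q \<in> A k \<Longrightarrow> p + q \<in> A k"
    and A_smult: "\<And>k c p. p \<in> A k \<Longrightarrow> smult c p \<in> A k"
    and A_shift: "\<And>k n p. p \<in> A k \<Longrightarrow> t n * p \<in> A (n + k)"
    and "finite I"
    and "\<And>l. l \<in> I \<Longrightarrow> a l + b l = D \<and> a l \<le> b l"
    and "\<And>l i. l \<in> I \<Longrightarrow> u l i \<in> A (a l) \<and> v l i \<in> A (b l)"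
    and "\<And>i j. wedge_sum I (\<lambda>l i. e (a l) (u l i)) (\<lambda>l i. e (b l) (v l i)) i j = 0"
  shows "\<exists>u' v' a' b'. wedge_sum I u' v' = wedge_sum I u v \<and>
    (\<forall>l\<in>I. a' l + b' l = D \<and> (\<forall>i. u' l i \<in> A (a' l) \<and> v' l i \<in> A (b' l) \<and> e (a' l) (u' l i) = 0))"
  using assms(7-)
proof (induction I arbitrary: u v rule: finite_ranking_induct[where f = b])
  case empty
  then show ?case by auto
next
  case (insert p S)
  show ?case
  \<comment> \<open>The ranking induction gives maximality of \<open>b p\<close>, but not that
    \<open>p\<close> is new.\<close>
  proof (cases "p \<in> S")
    case True
    then have eq: "insert p S = S" by auto
    show ?thesis unfolding eq by (rule insert.IH) (use insert.prems[unfolded eq] in auto)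
  next
    case False
    note S = \<open>finite S\<close> False
    \<comment> \<open>Common ending of both cases: \<open>p\<close> receives the finished pair
      \<open>(y, z)\<close>, and the induction hypothesis treats the modified pairs over
      \<open>S\<close>.\<close>
    have extend: ?thesis
      if wedge: "\<And>i j. wedge_sum S uS vS i j + (y i * z j - z i * y j) = wedge_sum (insert p S) u v i j"
        and mem: "\<And>l i. l \<in> S \<Longrightarrow> uS l i \<in> A (a l) \<and> vS l i \<in> A (b l)"
        and zero: "\<And>i j. wedge_sum S (\<lambda>l i. e (a l) (uS l i)) (\<lambda>l i. e (b l) (vS l i)) i j = 0"
        and pair: "ay + bz = D" "\<And>i. y i \<in> A ay" "\<And>i. z i \<in> A bz" "\<And>i. e ay (y i) = 0"
      for uS vS y z ay bz
    proof -
      obtain u' v' a' b' where IH: "wedge_sum S u' v' = wedge_sum S uS vS"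
        "\<forall>l\<in>S. a' l + b' l = D \<and> (\<forall>i. u' l i \<in> A (a' l) \<and> v' l i \<in> A (b' l) \<and> e (a' l) (u' l i) = 0)"
        using insert.IH[of uS vS] mem zero insert.prems(1) by blast
      have "wedge_sum S (u'(p := y)) (v'(p := z)) = wedge_sum S uS vS"
        unfolding IH(1)[symmetric] by (rule wedge_sum_cong) (use S in auto)
      then have "wedge_sum (insert p S) (u'(p := y)) (v'(p := z)) = wedge_sum (insert p S) u v"
        using wedge S by (simp add: fun_eq_iff wedge_sum_insert)
      moreover have "\<forall>l\<in>insert p S. (a'(p := ay)) l + (b'(p := bz)) l = D \<and>
          (\<forall>i. (u'(p := y)) l i \<in> A ((a'(p := ay)) l) \<and> (v'(p := z)) l i \<in> A ((b'(p := bz)) l) \<and>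
            e ((a'(p := ay)) l) ((u'(p := y)) l i) = 0)"
        using IH(2) pair S by auto
      ultimately show ?thesis by blast
    qed
    show ?thesis
    proof (cases "\<forall>i. e (a p) (u p i) = 0")
      case True
      show ?thesis
      proof (rule extend)
        show "wedge_sum S u v i j + (u p i * v p j - v p i * u p j) = wedge_sum (insert p S) u v i j" for i j
          using S by (simp add: wedge_sum_insert)
        show "wedge_sum S (\<lambda>l i. e (a l) (u l i)) (\<lambda>l i. e (b l) (v l i)) i j = 0" for i j
          using insert.prems(3)[of i j] S True by (simp add: wedge_sum_insert)
      qed (use insert.prems True in auto)
    next
      case False
      then obtain c where x: "e (a p) (u p c) \<noteq> 0" by blast
      \<comment> \<open>After applying \<open>e\<close>, subtracting these multiples of
        \<open>u p\<close> clears coordinate \<open>c\<close> of the other vectors. The powers of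
        \<open>t\<close> in \<open>g\<close> and \<open>f\<close> only match the levels;
        \<open>le\<close> and \<open>apb\<close> show that the differences of naturals are
        exact.\<close>
      define g0 where "g0 l = e (a l) (u l c) / e (a p) (u p c)" for l
      define f0 where "f0 l = e (b l) (v l c) / e (a p) (u p c)" for l
      define g where "g l = smult (g0 l) (t (a l - a p))" for l
      define f where "f l = smult (f0 l) (t (b l - a p))" for l
      define z where "z i = v p i - f p * u p i + (\<Sum>l\<in>S. g l * v l i - f l * u l i)" for i
      have e_minus: "e k (- q) = - e k q" for k q
        using e_smult[of k "-1" q] by simp
      have e_diff: "e k (q - q') = e k q - e k q'" for k q q'
        using e_add[of k q "- q'"] e_minus by simp
      have e_sum: "e k (sum h J) = (\<Sum>l\<in>J. e k (h l))" for k h and J :: "'i set"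
        using e_smult[of k 0 0] by (induction J rule: infinite_finite_induct) (simp_all add: e_add)
      have A_minus: "- q \<in> A k" if "q \<in> A k" for k q
        using A_smult[OF that, of "-1"] by simp
      have A_diff: "q - q' \<in> A k" if "q \<in> A k" "q' \<in> A k" for k q q'
        using A_add[OF that(1) A_minus[OF that(2)]] by simp
      have le: "a p \<le> a l" "a p \<le> b l" "b p = (a l - a p) + b l" "b p = (b l - a p) + a l" if "l \<in> S" for l
        using insert.prems(1)[of l] insert.prems(1)[of p] insert.hyps(2)[OF that] that by auto
      have zero_in: "0 \<in> A (b p)"
        using A_smult[of "v p 0" "b p" 0] insert.prems(2)[of p 0] by simp
      have A_sum: "sum h J \<in> A (b p)" if "\<And>l. l \<in> J \<Longrightarrow> h l \<in> A (b p)" for h and J :: "'i set"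
        using that zero_in by (induction J rule: infinite_finite_induct) (auto intro: A_add)
      have memS: "u l i \<in> A (a l)" "v l i \<in> A (b l)" if "l \<in> insert p S" for l i
        using insert.prems(2) that by auto
      have shift: "smult k (t (n - a p)) * q \<in> A n'" "e n' (smult k (t (n - a p)) * q) = k * e n'' q"
        if "q \<in> A n''" "n' = (n - a p) + n''" for k n n' n'' q
        using that A_smult[OF A_shift[OF that(1), of "n - a p"], of k] e_shift[of "n - a p" n'' q]
        by (simp_all add: e_smult)
      have apb: "b p = (b p - a p) + a p" using insert.prems(1)[of p] by simp
      have sub: "g l * u p i \<in> A (a l)" "e (a l) (g l * u p i) = g0 l * e (a p) (u p i)"
          "f l * u p i \<in> A (b l)" "e (b l) (f l * u p i) = f0 l * e (a p) (u p i)" if "l \<in> S" for l i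
        unfolding g_def f_def by (rule shift[OF memS(1)]; use le[OF that] in simp)+
      have z_in: "z i \<in> A (b p)" for i
      proof -
        have "f p * u p i \<in> A (b p)"
          unfolding f_def by (rule shift(1)[OF memS(1) apb]) simp
        moreover have "g l * v l i \<in> A (b p)" "f l * u l i \<in> A (b p)" if "l \<in> S" for l
          unfolding g_def f_def
          by (rule shift(1)[OF memS(2) le(3)] shift(1)[OF memS(1) le(4)]; use that in simp)+
        ultimately show ?thesis
          unfolding z_def by (intro A_add A_diff A_sum) (use memS in auto)
      qed
      have ez: "e (b p) (z i) = e (b p) (v p i) - f0 p * e (a p) (u p i) +
          (\<Sum>l\<in>S. g0 l * e (b l) (v l i) - f0 l * e (a l) (u l i))" for i
      proof -
        have "e (b p) (f p * u p i) = f0 p * e (a p) (u p i)"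
          unfolding f_def by (rule shift(2)[OF memS(1) apb]) simp
        moreover have "e (b p) (g l * v l i) = g0 l * e (b l) (v l i)"
            "e (b p) (f l * u l i) = f0 l * e (a l) (u l i)" if "l \<in> S" for l
          unfolding g_def f_def
          by (rule shift(2)[OF memS(2) le(3)] shift(2)[OF memS(1) le(4)]; use that in simp)+
        ultimately show ?thesis
          unfolding z_def e_add e_diff e_sum by simp
      qed
      \<comment> \<open>Row \<open>c\<close> of the vanishing sum, regrouped, is the nonzero pivot
        times the image of \<open>z\<close>.\<close>
      have ez0: "e (b p) (z i) = 0" for i
      proof -
        have "e (a p) (u p c) * e (b p) (z i) =
            wedge_sum (insert p S) (\<lambda>l i. e (a l) (u l i)) (\<lambda>l i. e (b l) (v l i)) c i"
          using x S by (simp add: ez g0_def f0_def wedge_sum_insert wedge_sum_def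
              sum_distrib_left sum_subtractf algebra_simps)
        then show ?thesis using insert.prems(3) x by simp
      qed
      show ?thesis
      \<comment> \<open>The roles are exchanged: the vanishing vector \<open>z\<close> comes first,
        at level \<open>b p\<close>, and the sign of \<open>- u p\<close> compensates the
        swap.\<close>
      proof (rule extend[where y = z and z = "\<lambda>i. - u p i" and ay = "b p" and bz = "a p"
            and uS = "\<lambda>l i. u l i - g l * u p i" and vS = "\<lambda>l i. v l i - f l * u p i"])
        show "wedge_sum S (\<lambda>l i. u l i - g l * u p i) (\<lambda>l i. v l i - f l * u p i) i j +
            (z i * - u p j - - u p i * z j) = wedge_sum (insert p S) u v i j" for i j
          using wedge_sum_shear[OF S(1), of u g "u p" v f i j "v p" "f p"] S
          by (simp add: wedge_sum_insert z_def)
        show "u l i - g l * u p i \<in> A (a l) \<and> v l i - f l * u p i \<in> A (b l)" if "l \<in> S" for l i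
          using that by (simp add: A_diff sub memS)
        show "wedge_sum S (\<lambda>l i. e (a l) (u l i - g l * u p i)) (\<lambda>l i. e (b l) (v l i - f l * u p i)) i j = 0" for i j
        proof -
          have "wedge_sum S (\<lambda>l i. e (a l) (u l i - g l * u p i)) (\<lambda>l i. e (b l) (v l i - f l * u p i)) i j
            = wedge_sum S (\<lambda>l i. e (a l) (u l i) - g0 l * e (a p) (u p i))
                (\<lambda>l i. e (b l) (v l i) - f0 l * e (a p) (u p i)) i j"
            unfolding wedge_sum_def
          proof (rule sum.cong[OF refl])
            fix l assume l: "l \<in> S"
            from sub[OF l] show "e (a l) (u l i - g l * u p i) * e (b l) (v l j - f l * u p j) -
              e (b l) (v l i - f l * u p i) * e (a l) (u l j - g l * u p j) =
              (e (a l) (u l i) - g0 l * e (a p) (u p i)) * (e (b l) (v l j) - f0 l * e (a p) (u p j)) -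
              (e (b l) (v l i) - f0 l * e (a p) (u p i)) * (e (a l) (u l j) - g0 l * e (a p) (u p j))"
              by (simp add: e_diff)
          qed
          also have "\<dots> = 0"
            using wedge_sum_shear[OF S(1), of "\<lambda>l i. e (a l) (u l i)" g0 "\<lambda>i. e (a p) (u p i)"
                "\<lambda>l i. e (b l) (v l i)" f0 i j "\<lambda>i. e (b p) (v p i)" "f0 p"]
              ez0[unfolded ez] insert.prems(3)[of i j] S by (simp add: wedge_sum_insert)
          finally show ?thesis .
        qed
      qed (use ez0 z_in memS A_minus insert.prems(1)[of p] in auto)
    qed
  qed
qed

section \<open>Normalization at finite points and at infinity\<close>

text \<open>Swapping the vectors of a pair and negating one keeps the bivector. This restores the
  order of levels that \<open>pivot_elimination\<close> requires but need not return.\<close>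

lemma swap_to_le:
  fixes u v :: "'i \<Rightarrow> nat \<Rightarrow> 'a::comm_ring" and a b :: "'i \<Rightarrow> nat"
  assumes "\<And>l i. l \<in> I \<Longrightarrow> u l i \<in> A (a l) \<and> v l i \<in> A (b l)"
    and "\<And>k p. p \<in> A k \<Longrightarrow> - p \<in> A k"
  obtains u' v' a' b' where "wedge_sum I u' v' = wedge_sum I u v"
    "\<And>l. a' l + b' l = a l + b l" "\<And>l. a' l \<le> b' l"
    "\<And>l i. l \<in> I \<Longrightarrow> u' l i \<in> A (a' l) \<and> v' l i \<in> A (b' l)"
proof
  let ?u = "\<lambda>l. if a l \<le> b l then u l else v l"
  let ?v = "\<lambda>l. if a l \<le> b l then v l else (\<lambda>i. - u l i)"
  show "wedge_sum I ?u ?v = wedge_sum I u v"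
    unfolding wedge_sum_def fun_eq_iff by (auto intro!: sum.cong)
  show "min (a l) (b l) + max (a l) (b l) = a l + b l" "min (a l) (b l) \<le> max (a l) (b l)" for l
    by auto
  show "?u l i \<in> A (min (a l) (b l)) \<and> ?v l i \<in> A (max (a l) (b l))" if "l \<in> I" for l i
    using assms(1)[OF that] assms(2) by (auto simp: min_def max_def)
qed

text \<open>The coefficient of the sum at \<open>Suc D\<close> is the bivector sum of the
  coefficient vectors at \<open>a l\<close> and \<open>b l\<close>. As it vanishes,
  \<open>pivot_elimination\<close> at infinity clears the top coefficients of the first vectors,
  whose bounds then drop by one.\<close>

lemma degree_drop:
  assumes "finite I"
    and "\<And>l. l \<in> I \<Longrightarrow> a l + b l = Suc D"
    and "\<And>l i. l \<in> I \<Longrightarrow> degree (u l i) \<le> a l \<and> degree (v l i) \<le> b l"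
    and "\<And>i j. degree (wedge_sum I u v i j :: complex poly) \<le> D"
  shows "\<exists>u' v' a' b'. wedge_sum I u' v' = wedge_sum I u v \<and>
    (\<forall>l\<in>I. a' l + b' l = D \<and> (\<forall>i. degree (u' l i) \<le> a' l \<and> degree (v' l i) \<le> b' l))"
proof -
  let ?A = "\<lambda>k. {p :: complex poly. degree p \<le> k}"
  obtain u1 v1 a1 b1 where 1: "wedge_sum I u1 v1 = wedge_sum I u v"
    "\<And>l. a1 l + b1 l = a l + b l" "\<And>l. a1 l \<le> b1 l"
    "\<And>l i. l \<in> I \<Longrightarrow> u1 l i \<in> ?A (a1 l) \<and> v1 l i \<in> ?A (b1 l)"
    by (rule swap_to_le[of I u ?A a v b]) (use assms(3) in auto)
  have top: "coeff (p * q) (Suc D) = coeff p m * coeff q n"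
    if "degree p \<le> m" "degree q \<le> n" "m + n = Suc D" for p q :: "complex poly" and m n
  proof -
    have "coeff (p * q) (Suc D) = (\<Sum>i\<in>{m}. coeff p i * coeff q (Suc D - i))"
      unfolding coeff_mult
    proof (rule sum.mono_neutral_right)
      show "\<forall>i\<in>{..Suc D} - {m}. coeff p i * coeff q (Suc D - i) = 0"
      proof
        fix i assume "i \<in> {..Suc D} - {m}"
        then have "m < i \<or> n < Suc D - i" using that by auto
        then show "coeff p i * coeff q (Suc D - i) = 0"
          using that by (auto simp: coeff_eq_0)
      qed
    qed (use that in auto)
    moreover have "Suc D - m = n" using that by simp
    ultimately show ?thesis by simp
  qed
  have "wedge_sum I (\<lambda>l i. coeff (u1 l i) (a1 l)) (\<lambda>l i. coeff (v1 l i) (b1 l)) i j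
      = coeff (wedge_sum I u1 v1 i j) (Suc D)" for i j
    unfolding wedge_sum_def coeff_sum coeff_diff
  proof (rule sum.cong[OF refl])
    fix l assume l: "l \<in> I"
    have "a1 l + b1 l = Suc D" "b1 l + a1 l = Suc D"
      using 1(2)[of l] assms(2)[OF l] by auto
    then show "coeff (u1 l i) (a1 l) * coeff (v1 l j) (b1 l) - coeff (v1 l i) (b1 l) * coeff (u1 l j) (a1 l)
      = coeff (u1 l i * v1 l j) (Suc D) - coeff (v1 l i * u1 l j) (Suc D)"
      using 1(4)[OF l] top[of "u1 l i" "a1 l" "v1 l j" "b1 l"] top[of "v1 l i" "b1 l" "u1 l j" "a1 l"]
      by simp
  qed
  then have zero: "wedge_sum I (\<lambda>l i. coeff (u1 l i) (a1 l)) (\<lambda>l i. coeff (v1 l i) (b1 l)) i j = 0" for i j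
    using assms(4)[of i j] 1(1) by (simp add: coeff_eq_0)
  have "\<exists>u2 v2 a2 b2. wedge_sum I u2 v2 = wedge_sum I u1 v1 \<and> (\<forall>l\<in>I. a2 l + b2 l = Suc D \<and>
       (\<forall>i. u2 l i \<in> ?A (a2 l) \<and> v2 l i \<in> ?A (b2 l) \<and> coeff (u2 l i) (a2 l) = 0))"
  proof (rule pivot_elimination[where e = "\<lambda>k p. coeff p k" and t = "monom 1" and a = a1 and b = b1])
    show "monom 1 n * p \<in> ?A (n + k)" if "p \<in> ?A k" for k n p
      using degree_mult_le[of "monom 1 n" p] degree_monom_le[of "1 :: complex" n] that by simp
    show "smult c p \<in> ?A k" if "p \<in> ?A k" for k c p
      using degree_smult_le[of c p] that by simp
    show "u1 l i \<in> ?A (a1 l) \<and> v1 l i \<in> ?A (b1 l)" if "l \<in> I" for l i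
      using 1(4) that .
    show "a1 l + b1 l = Suc D \<and> a1 l \<le> b1 l" if "l \<in> I" for l
      using 1(2,3) assms(2) that by simp
  qed (use assms(1) zero in \<open>auto simp: coeff_monom_mult degree_add_le\<close>)
  then obtain u2 v2 a2 b2 where 2: "wedge_sum I u2 v2 = wedge_sum I u1 v1"
    "\<forall>l\<in>I. a2 l + b2 l = Suc D \<and>
       (\<forall>i. u2 l i \<in> ?A (a2 l) \<and> v2 l i \<in> ?A (b2 l) \<and> coeff (u2 l i) (a2 l) = 0)"
    by blast
  \<comment> \<open>A bound \<open>a2 l = 0\<close> cannot drop; but then \<open>u2 l\<close> is
    zero, so its partner may be replaced by zero and given the bound \<open>D\<close>.\<close>
  let ?v = "\<lambda>l i. if a2 l = 0 then 0 else v2 l i"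
  have u0: "u2 l i = 0" if "l \<in> I" "a2 l = 0" for l i
    using 2(2) that by (metis (no_types, lifting) le_0_eq leading_coeff_0_iff mem_Collect_eq)
  have "wedge_sum I u2 ?v = wedge_sum I u2 v2"
    using u0 by (auto simp: wedge_sum_def fun_eq_iff intro!: sum.cong)
  moreover have "(a2 l - 1) + (if a2 l = 0 then D else b2 l) = D \<and>
      (\<forall>i. degree (u2 l i) \<le> a2 l - 1 \<and> degree (?v l i) \<le> (if a2 l = 0 then D else b2 l))" if "l \<in> I" for l
  proof (cases "a2 l = 0")
    case True
    then show ?thesis using u0[OF that] by simp
  next
    case False
    have "degree (u2 l i) \<le> a2 l - 1" for i
    proof (rule degree_le, intro allI impI)
      fix k assume "a2 l - 1 < k"
      moreover have "degree (u2 l i) \<le> a2 l" "coeff (u2 l i) (a2 l) = 0"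
        using bspec[OF 2(2) \<open>l \<in> I\<close>] by auto
      ultimately show "coeff (u2 l i) k = 0"
        by (cases "k = a2 l") (auto intro!: coeff_eq_0)
    qed
    then show ?thesis using 2(2) that False by auto
  qed
  ultimately show ?thesis
    using 1(1) 2(1)
    by (intro exI[of _ u2] exI[of _ ?v] exI[of _ "\<lambda>l. a2 l - 1"] exI[of _ "\<lambda>l. if a2 l = 0 then D else b2 l"])
      simp
qed

lemma degree_normalization:
  assumes "finite I"
    and "\<And>l. l \<in> I \<Longrightarrow> a l + b l = d + n"
    and "\<And>l i. l \<in> I \<Longrightarrow> degree (u l i) \<le> a l \<and> degree (v l i) \<le> b l"
    and "\<And>i j. degree (wedge_sum I u v i j :: complex poly) \<le> d"
  shows "\<exists>u' v' a' b'. wedge_sum I u' v' = wedge_sum I u v \<and>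
    (\<forall>l\<in>I. a' l + b' l = d \<and> (\<forall>i. degree (u' l i) \<le> a' l \<and> degree (v' l i) \<le> b' l))"
  using assms(2-)
proof (induction n arbitrary: u v a b)
  case 0
  then show ?case by (intro exI[of _ u] exI[of _ v] exI[of _ a] exI[of _ b]) auto
next
  case (Suc n)
  have "\<exists>u' v' a' b'. wedge_sum I u' v' = wedge_sum I u v \<and>
    (\<forall>l\<in>I. a' l + b' l = d + n \<and> (\<forall>i. degree (u' l i) \<le> a' l \<and> degree (v' l i) \<le> b' l))"
    by (rule degree_drop[OF assms(1)]) (use Suc.prems in \<open>auto intro: trans_le_add1\<close>)
  then obtain u' v' a' b' where *: "wedge_sum I u' v' = wedge_sum I u v"
    "\<forall>l\<in>I. a' l + b' l = d + n \<and> (\<forall>i. degree (u' l i) \<le> a' l \<and> degree (v' l i) \<le> b' l)"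
    by blast
  show ?case
    using Suc.IH[of a' b' u' v'] * Suc.prems(3) by simp
qed

text \<open>With \<open>e\<close> as evaluation at \<open>\<alpha>\<close>,
  \<open>pivot_elimination\<close> makes all first vectors vanish there. Dividing just these by the
  linear factor suffices, as a bivector is linear in its first vector.\<close>

lemma root_division:
  assumes "finite I" and "\<And>i j. poly (wedge_sum I u v i j :: complex poly) \<alpha> = 0"
  shows "\<exists>u' v'. \<forall>i j. wedge_sum I u v i j = [:- \<alpha>, 1:] * wedge_sum I u' v' i j"
proof -
  have "wedge_sum I (\<lambda>l i. poly (u l i) \<alpha>) (\<lambda>l i. poly (v l i) \<alpha>) i j = 0" for i j
    using assms(2)[of i j] by (simp add: wedge_sum_def poly_sum)
  then obtain u' v' where 1: "wedge_sum I u' v' = wedge_sum I u v"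
    "\<forall>l\<in>I. \<forall>i. poly (u' l i) \<alpha> = 0"
    using pivot_elimination[where e = "\<lambda>k p. poly p \<alpha>" and t = "\<lambda>_. 1" and A = "\<lambda>_. UNIV" and I = I
        and u = u and v = v and a = "\<lambda>_. 0" and b = "\<lambda>_. 0" and D = 0] assms(1) by auto
  define w where "w l i = u' l i div [:- \<alpha>, 1:]" for l i
  have "u' l i = [:- \<alpha>, 1:] * w l i" if "l \<in> I" for l i
    using 1(2) that unfolding w_def by (metis poly_eq_0_iff_dvd dvd_mult_div_cancel)
  then have "wedge_sum I u' v' = wedge_sum I (\<lambda>l i. [:- \<alpha>, 1:] * w l i) v'"
    by (intro wedge_sum_cong) auto
  moreover have "wedge_sum I (\<lambda>l i. [:- \<alpha>, 1:] * w l i) v' i j = [:- \<alpha>, 1:] * wedge_sum I w v' i j" for i j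
    by (simp only: wedge_sum_def sum_distrib_left right_diff_distrib mult_ac)
  ultimately show ?thesis using 1(1) by metis
qed

text \<open>Over the complex numbers \<open>q\<close> splits, so \<open>root_division\<close>
  removes one linear factor at a time; the remaining constant is absorbed into
  \<open>u\<close>.\<close>

lemma wedge_sum_cancel_factor:
  assumes "finite I" and "q \<noteq> 0" and "\<And>i j. q * P i j = (wedge_sum I u v i j :: complex poly)"
  shows "\<exists>u' v'. P = wedge_sum I u' v'"
  using assms(2,3)
proof (induction "degree q" arbitrary: q u v)
  case 0
  then obtain c where q: "q = [:c:]" "c \<noteq> 0" by (metis degree_0_id pCons_eq_0_iff poly_eq_iff degree_eq_zeroE)
  have "P i j = wedge_sum I (\<lambda>l i. [:inverse c:] * u l i) v i j" for i j
  proof -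
    have "P i j = [:inverse c:] * (q * P i j)" using q by simp
    also have "\<dots> = wedge_sum I (\<lambda>l i. [:inverse c:] * u l i) v i j"
      unfolding 0 by (simp only: wedge_sum_def sum_distrib_left right_diff_distrib mult_ac)
    finally show ?thesis .
  qed
  then show ?case by blast
next
  case (Suc n)
  obtain \<alpha> where \<alpha>: "poly q \<alpha> = 0"
    using Suc.hyps(2) by (metis fundamental_theorem_of_algebra constant_degree nat.distinct(1))
  then obtain q' where q': "q = [:- \<alpha>, 1:] * q'" by (metis dvdE poly_eq_0_iff_dvd)
  have "poly (wedge_sum I u v i j) \<alpha> = 0" for i j
    using \<alpha> by (simp flip: Suc.prems(2))
  then obtain u' v' where "\<And>i j. wedge_sum I u v i j = [:- \<alpha>, 1:] * wedge_sum I u' v' i j"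
    using root_division[OF assms(1), of u v \<alpha>] by blast
  then have *: "[:- \<alpha>, 1:] * (q' * P i j) = [:- \<alpha>, 1:] * wedge_sum I u' v' i j" for i j
    using Suc.prems(2)[of i j] q' by (metis mult.assoc)
  have "q' * P i j = wedge_sum I u' v' i j" for i j
    using *[of i j] by (simp only: mult_cancel_left) simp
  moreover have nz: "q' \<noteq> 0" using Suc.prems(1) q' by auto
  moreover have "degree q = Suc (degree q')"
    unfolding q' using nz by (subst degree_mult_eq) auto
  then have "n = degree q'" using Suc.hyps(2) by simp
  ultimately show ?case using Suc.hyps(1) by blast
qed

section \<open>Ranks and skew-symmetric elimination\<close>

text \<open>Over a domain this is rank at most \<open>s\<close> over the field of fractions, with
  denominators cleared. Repetitions in \<open>f\<close> are harmless, since equal columns are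
  dependent.\<close>

definition cols_dep :: "nat \<Rightarrow> (nat \<Rightarrow> nat \<Rightarrow> 'a::comm_ring_1) \<Rightarrow> bool" where
  "cols_dep s P \<longleftrightarrow> (\<forall>f. \<exists>c. (\<exists>l\<le>s. c l \<noteq> 0) \<and> (\<forall>i. (\<Sum>l\<le>s. c l * P i (f l)) = 0))"

text \<open>A zero row makes the system square and singular, and a singular matrix over a domain has
  a nonzero kernel vector over that domain.\<close>

lemma underdetermined_system:
  fixes M :: "nat \<Rightarrow> nat \<Rightarrow> 'a::idom"
  obtains c where "\<exists>l\<le>s. c l \<noteq> 0" "\<And>k. k < s \<Longrightarrow> (\<Sum>l\<le>s. M k l * c l) = 0"
proof -
  let ?A = "mat (Suc s) (Suc s) (\<lambda>(k, l). if k < s then M k l else 0)"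
  have A: "?A \<in> carrier_mat (Suc s) (Suc s)" by simp
  have *: "?A = mat\<^sub>r (Suc s) (Suc s) (\<lambda>i. if i = s then 0\<^sub>v (Suc s) else row ?A i)"
    by (rule eq_matI) auto
  have "det ?A = 0"
    by (subst *, rule det_row_0) auto
  then obtain v where v: "v \<in> carrier_vec (Suc s)" "v \<noteq> 0\<^sub>v (Suc s)" "?A *\<^sub>v v = 0\<^sub>v (Suc s)"
    using det_0_iff_vec_prod_zero[OF A] by blast
  show thesis
  proof (rule that)
    show "\<exists>l\<le>s. v $ l \<noteq> 0"
      using v(1,2) by (metis (no_types, lifting) carrier_vecD eq_vecI index_zero_vec less_Suc_eq_le)
    show "(\<Sum>l\<le>s. M k l * v $ l) = 0" if "k < s" for k
    proof -
      have "(?A *\<^sub>v v) $ k = (\<Sum>l\<in>{0..<Suc s}. M k l * v $ l)"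
        using v(1) that by (simp add: scalar_prod_def del: sum.op_ivl_Suc)
      then show ?thesis
        using v(3) that by (simp add: atLeast0LessThan lessThan_Suc_atMost del: sum.op_ivl_Suc)
    qed
  qed
qed

text \<open>The columns of \<open>q\<close> times \<open>P\<close> are combinations of the
  \<open>2 * r\<close> vectors \<open>u k\<close> and \<open>v k\<close>, so a relation among
  \<open>2 * r + 1\<close> of them need only satisfy \<open>2 * r\<close> equations.\<close>

lemma cols_dep_wedge_sum:
  fixes P :: "nat \<Rightarrow> nat \<Rightarrow> 'a::idom"
  assumes "q \<noteq> 0" and "\<And>i j. q * P i j = wedge_sum {..<r} u v i j"
  shows "cols_dep (2 * r) P"
  unfolding cols_dep_def
proof
  fix f :: "nat \<Rightarrow> nat"
  obtain c where c: "\<exists>l\<le>2 * r. c l \<noteq> 0"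
    and sys: "\<And>k. k < 2 * r \<Longrightarrow> (\<Sum>l\<le>2 * r. (if k < r then v k (f l) else u (k - r) (f l)) * c l) = 0"
    by (rule underdetermined_system[of "2 * r" "\<lambda>k l. if k < r then v k (f l) else u (k - r) (f l)"])
      (rule that)
  have v0: "(\<Sum>l\<le>2 * r. c l * v k (f l)) = 0" and u0: "(\<Sum>l\<le>2 * r. c l * u k (f l)) = 0" if "k < r" for k
    using sys[of k] sys[of "k + r"] that by (simp_all add: mult.commute)
  have "q * (\<Sum>l\<le>2 * r. c l * P i (f l)) = 0" for i
  proof -
    have "q * (\<Sum>l\<le>2 * r. c l * P i (f l)) = (\<Sum>l\<le>2 * r. c l * wedge_sum {..<r} u v i (f l))"
      by (simp add: sum_distrib_left mult.left_commute flip: assms(2))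
    also have "\<dots> = (\<Sum>l\<le>2 * r. \<Sum>k<r. u k i * (c l * v k (f l)) - v k i * (c l * u k (f l)))"
      unfolding wedge_sum_def sum_distrib_left by (intro sum.cong refl) (simp add: algebra_simps)
    also have "\<dots> = (\<Sum>k<r. \<Sum>l\<le>2 * r. u k i * (c l * v k (f l)) - v k i * (c l * u k (f l)))"
      by (rule sum.swap)
    also have "\<dots> = (\<Sum>k<r. u k i * (\<Sum>l\<le>2 * r. c l * v k (f l)) - v k i * (\<Sum>l\<le>2 * r. c l * u k (f l)))"
      by (simp add: sum_subtractf sum_distrib_left)
    also have "\<dots> = 0" by (simp add: u0 v0)
    finally show ?thesis .
  qed
  then show "\<exists>c. (\<exists>l\<le>2 * r. c l \<noteq> 0) \<and> (\<forall>i. (\<Sum>l\<le>2 * r. c l * P i (f l)) = 0)"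
    using c assms(1) by auto
qed

text \<open>For skew-symmetric \<open>P\<close> with zero diagonal and \<open>P h k\<close> nonzero,
  this is \<open>P h k\<close> times the Schur complement of the block on \<open>h\<close> and
  \<open>k\<close>. It is also the Pfaffian of the 4 by 4 matrix on the indices \<open>h\<close>,
  \<open>k\<close>, \<open>i\<close>, \<open>j\<close>.\<close>

definition skew_elim :: "nat \<Rightarrow> nat \<Rightarrow> (nat \<Rightarrow> nat \<Rightarrow> 'a::comm_ring) \<Rightarrow> nat \<Rightarrow> nat \<Rightarrow> 'a" where
  "skew_elim h k P i j = P h k * P i j - (P h i * P k j - P k i * P h j)"

lemma skew_elim_skew:
  assumes "\<And>i j. P i j = - P j i"
  shows "skew_elim h k P i j = - skew_elim h k P j i"
  unfolding skew_elim_def using assms[of i j] by (simp add: algebra_simps)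

text \<open>Columns \<open>h\<close> and \<open>k\<close> are appended to the given ones. A relation
  of \<open>P\<close> passes to the complement, where these two columns vanish.\<close>

lemma cols_dep_skew_elim:
  fixes P :: "nat \<Rightarrow> nat \<Rightarrow> 'a::{idom, ring_char_0}"
  assumes skew: "\<And>i j. P i j = - P j i" and x: "P h k \<noteq> 0" and dep: "cols_dep (Suc (Suc s)) P"
  shows "cols_dep s (skew_elim h k P)"
  unfolding cols_dep_def
proof
  fix f :: "nat \<Rightarrow> nat"
  have diag: "P i i = 0" for i
  proof -
    have "2 * P i i = 0" using skew[of i i] by (metis add.right_inverse mult_2)
    then show ?thesis by simp
  qed
  let ?f = "\<lambda>l. if l \<le> s then f l else if l = Suc s then h else k"
  obtain c where c: "\<exists>l\<le>Suc (Suc s). c l \<noteq> 0" "\<And>i. (\<Sum>l\<le>Suc (Suc s). c l * P i (?f l)) = 0"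
    using spec[OF dep[unfolded cols_dep_def], of ?f] by blast
  have rel: "(\<Sum>l\<le>s. c l * P i (f l)) = - c (Suc s) * P i h - c (Suc (Suc s)) * P i k" for i
    using c(2)[of i] by (simp add: algebra_simps eq_neg_iff_add_eq_0)
  have "(\<Sum>l\<le>s. c l * skew_elim h k P i (f l)) = 0" for i
  proof -
    have "(\<Sum>l\<le>s. c l * skew_elim h k P i (f l)) =
        (\<Sum>l\<le>s. P h k * (c l * P i (f l)) - P h i * (c l * P k (f l)) + P k i * (c l * P h (f l)))"
      by (simp add: skew_elim_def algebra_simps)
    also have "\<dots> = P h k * (\<Sum>l\<le>s. c l * P i (f l)) - P h i * (\<Sum>l\<le>s. c l * P k (f l))
        + P k i * (\<Sum>l\<le>s. c l * P h (f l))"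
      by (simp add: sum.distrib sum_subtractf sum_distrib_left)
    also have "\<dots> = 0"
      unfolding rel using skew[of i h] skew[of i k] skew[of k h] by (simp add: diag algebra_simps)
    finally show ?thesis .
  qed
  \<comment> \<open>Otherwise only columns \<open>h\<close> and \<open>k\<close> would be related,
    but on rows \<open>h\<close> and \<open>k\<close> they form an invertible skew block over the
    fractions.\<close>
  moreover have "\<exists>l\<le>s. c l \<noteq> 0"
  proof (rule ccontr)
    assume "\<not> ?thesis"
    then have z: "\<And>l. l \<le> s \<Longrightarrow> c l = 0" by blast
    then have "c (Suc s) * P i h + c (Suc (Suc s)) * P i k = 0" for i
      using rel[of i] by (simp add: algebra_simps eq_neg_iff_add_eq_0 add.commute)
    from this[of h] this[of k] have "c (Suc s) = 0" "c (Suc (Suc s)) = 0"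
      using x skew[of k h] by (simp_all add: diag)
    then show False using c(1) z by (metis le_Suc_eq)
  qed
  ultimately show "\<exists>c. (\<exists>l\<le>s. c l \<noteq> 0) \<and> (\<forall>i. (\<Sum>l\<le>s. c l * skew_elim h k P i (f l)) = 0)"
    by blast
qed

text \<open>By definition \<open>P h k\<close> times \<open>P\<close> is the complement plus the
  bivector of rows \<open>h\<close> and \<open>k\<close>; multiplying by \<open>q\<close> gives one
  more term.\<close>

lemma wedge_sum_skew_elim:
  fixes P :: "nat \<Rightarrow> nat \<Rightarrow> 'a::idom"
  assumes "P h k \<noteq> 0" "q \<noteq> 0" "\<And>i j. q * skew_elim h k P i j = wedge_sum {..<r} u v i j"
  shows "\<exists>q u v. q \<noteq> 0 \<and> (\<forall>i j. q * P i j = wedge_sum {..<Suc r} u v i j)"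
proof (intro exI conjI allI)
  show "q * P h k \<noteq> 0" using assms by simp
  fix i j
  let ?u = "u(r := \<lambda>i. q * P h i)" and ?v = "v(r := P k)"
  have "wedge_sum {..<r} ?u ?v = wedge_sum {..<r} u v"
    by (rule wedge_sum_cong) auto
  then show "q * P h k * P i j = wedge_sum {..<Suc r} ?u ?v i j"
    by (simp add: lessThan_Suc wedge_sum_insert skew_elim_def algebra_simps flip: assms(3))
qed

lemma cols_dep_0:
  fixes P :: "nat \<Rightarrow> nat \<Rightarrow> 'a::idom"
  assumes "cols_dep 0 P"
  shows "P i j = 0"
  using assms[unfolded cols_dep_def, rule_format, of "\<lambda>_. j"] by auto

text \<open>Each elimination at a nonzero entry splits off one bivector and lowers the rank bound by
  two.\<close>

lemma wedge_sum_of_cols_dep: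
  fixes P :: "nat \<Rightarrow> nat \<Rightarrow> 'a::{idom, ring_char_0}"
  assumes "\<And>i j. P i j = - P j i" and "cols_dep (2 * r) P"
  shows "\<exists>q u v. q \<noteq> 0 \<and> (\<forall>i j. q * P i j = wedge_sum {..<r} u v i j)"
  using assms
proof (induction r arbitrary: P)
  case 0
  have "P i j = 0" for i j using "0.prems"(2) by (simp add: cols_dep_0)
  then show ?case by (intro exI[of _ 1]) simp
next
  case (Suc r)
  show ?case
  proof (cases "\<forall>i j. P i j = 0")
    case True
    then show ?thesis by (intro exI[of _ 1] exI[of _ "\<lambda>_ _. 0"]) (simp add: wedge_sum_def)
  next
    case False
    then obtain h k where hk: "P h k \<noteq> 0" by blast
    have "cols_dep (2 * r) (skew_elim h k P)"
    proof (rule cols_dep_skew_elim)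
      show "P i j = - P j i" for i j by (rule Suc.prems(1))
      show "cols_dep (Suc (Suc (2 * r))) P" using Suc.prems(2) by simp
    qed (rule hk)
    with skew_elim_skew[of P, OF Suc.prems(1)]
    have "\<exists>q u v. q \<noteq> 0 \<and> (\<forall>i j. q * skew_elim h k P i j = wedge_sum {..<r} u v i j)"
      by (rule Suc.IH)
    then obtain q u v where "q \<noteq> 0" "\<And>i j. q * skew_elim h k P i j = wedge_sum {..<r} u v i j"
      by blast
    then show ?thesis by (rule wedge_sum_skew_elim[of P, OF hk])
  qed
qed

section \<open>Comparison of column dependence with the normal rank\<close>

lemma common_denominator:
  fixes w :: "'i \<Rightarrow> 'a::idom fract"
  assumes "finite L"
  obtains q c where "q \<noteq> 0" "\<And>l. l \<in> L \<Longrightarrow> to_fract (c l) = to_fract q * w l"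
proof -
  have "\<exists>q c. q \<noteq> 0 \<and> (\<forall>l\<in>L. to_fract (c l) = to_fract q * w l)"
    using assms
  proof (induction L rule: finite_induct)
    case empty
    then show ?case by (intro exI[of _ 1]) simp
  next
    case (insert x L)
    then obtain q c where qc: "q \<noteq> 0" "\<forall>l\<in>L. to_fract (c l) = to_fract q * w l" by blast
    obtain n d where nd: "w x = Fract n d" "d \<noteq> 0" by (cases "w x") auto
    have "to_fract d * w x = to_fract n"
      using nd by (simp add: to_fract_def eq_fract)
    then have "to_fract (((\<lambda>l. d * c l)(x := q * n)) l) = to_fract (q * d) * w l" if "l \<in> insert x L" for l
      using qc(2) insert.hyps(2) that by (auto simp: mult.assoc mult.left_commute)
    then show ?case using qc(1) nd(2) by (intro exI[of _ "q * d"] exI) auto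
  qed
  then show thesis using that by blast
qed

text \<open>Extension by zero lets skew-symmetry and column relations hold for all indices.\<close>

definition mat_fun :: "'a::zero mat \<Rightarrow> nat \<Rightarrow> nat \<Rightarrow> 'a" where
  "mat_fun P i j = (if i < dim_row P \<and> j < dim_col P then P $$ (i, j) else 0)"

text \<open>Columns out of range or repeated give an immediate relation. Otherwise
  \<open>s + 1\<close> distinct columns exceed the rank, and a common denominator turns their
  dependence into a polynomial relation.\<close>

lemma cols_dep_of_normal_rank:
  assumes "normal_rank P \<le> s"
  shows "cols_dep s (mat_fun P)"
  unfolding cols_dep_def
proof
  fix f :: "nat \<Rightarrow> nat"
  let ?K = "map_mat to_fract P" and ?n = "dim_row P"
  interpret vec_space "TYPE(complex poly fract)" ?n .
  have K: "?K \<in> carrier_mat ?n (dim_col P)" by simp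
  show "\<exists>c. (\<exists>l\<le>s. c l \<noteq> 0) \<and> (\<forall>i. (\<Sum>l\<le>s. c l * mat_fun P i (f l)) = 0)"
  proof (cases "\<exists>l\<le>s. dim_col P \<le> f l")
    case True
    then obtain l where l: "l \<le> s" "dim_col P \<le> f l" by blast
    have "(\<Sum>k\<le>s. (if k = l then 1 else 0) * mat_fun P i (f k)) = 0" for i
      using l by (intro sum.neutral) (auto simp: mat_fun_def)
    then show ?thesis using l by (intro exI[of _ "\<lambda>k. if k = l then 1 else 0"]) auto
  next
    case False
    then have f: "f l < dim_col P" if "l \<le> s" for l using that by (meson not_le)
    show ?thesis
    \<comment> \<open>Injectivity concerns the columns, not their indices, because independence is a
      property of sets of vectors.\<close>
    proof (cases "inj_on (\<lambda>l. col ?K (f l)) {..s}")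
      case False
      then obtain l k where lk: "l \<le> s" "k \<le> s" "l \<noteq> k" "col ?K (f l) = col ?K (f k)"
        by (auto simp: inj_on_def)
      have eq: "mat_fun P i (f l) = mat_fun P i (f k)" for i
      proof (cases "i < ?n")
        case True
        then have "to_fract (P $$ (i, f l)) = to_fract (P $$ (i, f k))"
          using arg_cong[OF lk(4), of "\<lambda>v. v $ i"] f lk(1,2) by simp
        then show ?thesis using True f lk(1,2) by (simp add: mat_fun_def)
      qed (simp add: mat_fun_def)
      let ?c = "\<lambda>h. (if h = l then 1 else 0) - (if h = k then 1 else 0 :: complex poly)"
      have "(\<Sum>h\<le>s. ?c h * mat_fun P i (f h)) = 0" for i
      proof -
        have "(\<Sum>h\<le>s. ?c h * mat_fun P i (f h)) = (\<Sum>h\<le>s. (if h = l then mat_fun P i (f h) else 0))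
            - (\<Sum>h\<le>s. (if h = k then mat_fun P i (f h) else 0))"
          unfolding sum_subtractf[symmetric] by (intro sum.cong refl) (simp add: algebra_simps)
        then show ?thesis using lk(1,2) eq by simp
      qed
      then show ?thesis using lk by (intro exI[of _ ?c]) auto
    next
      case True
      define vs where "vs = map (\<lambda>l. col ?K (f l)) [0..<Suc s]"
      define M where "M = mat_of_cols ?n vs"
      have len: "length vs = Suc s" by (simp add: vs_def del: upt_Suc)
      have vs: "set vs \<subseteq> carrier_vec ?n" by (auto simp: vs_def intro!: carrier_vecI)
      have nth: "vs ! l = col ?K (f l)" if "l \<le> s" for l
        using that by (simp add: vs_def del: upt_Suc)
      have M: "M \<in> carrier_mat ?n (Suc s)" using len by (auto simp: M_def)
      have cols: "cols M = vs" unfolding M_def by (rule cols_mat_of_cols[OF vs])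
      have dist: "distinct vs"
        unfolding vs_def distinct_map using True by (auto simp: inj_on_def)
      have sub: "set vs \<subseteq> set (cols ?K)"
        using f by (auto simp: vs_def cols_def)
      have "lin_dep (set (cols M))"
      proof (rule ccontr)
        assume "lin_indpt (set (cols M))"
        then have "card (set vs) \<le> rank ?K"
          using rank_ge_card_indpt[OF K sub] cols by simp
        then show False
          using assms distinct_card[OF dist] len by (simp add: normal_rank_def)
      qed
      then obtain w where w: "w \<in> carrier_vec (Suc s)" "w \<noteq> 0\<^sub>v (Suc s)" "M *\<^sub>v w = 0\<^sub>v ?n"
        using lin_depE[OF M] dist cols by metis
      obtain q c where q: "q \<noteq> 0" and c: "\<And>l. l \<in> {..s} \<Longrightarrow> to_fract (c l) = to_fract q * w $ l"
        using common_denominator[of "{..s}" "\<lambda>l. w $ l"] by auto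
      have "(\<Sum>l\<le>s. c l * mat_fun P i (f l)) = 0" for i
      proof (cases "i < ?n")
        case True
        have "(M *\<^sub>v w) $ i = (\<Sum>l\<in>{0..<Suc s}. M $$ (i, l) * w $ l)"
          using w(1) True M by (simp add: scalar_prod_def del: sum.op_ivl_Suc)
        also have "\<dots> = (\<Sum>l\<le>s. to_fract (P $$ (i, f l)) * w $ l)"
          using True f len nth
          by (intro sum.cong) (auto simp: M_def mat_of_cols_def)
        finally have "(\<Sum>l\<le>s. to_fract (P $$ (i, f l)) * w $ l) = 0" using w(3) True by simp
        then have "(\<Sum>l\<le>s. to_fract q * (to_fract (P $$ (i, f l)) * w $ l)) = 0"
          by (simp flip: sum_distrib_left)
        then have "(\<Sum>l\<le>s. to_fract (c l * mat_fun P i (f l))) = 0"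
          using True f c by (simp add: mat_fun_def mult_ac)
        then have "to_fract (\<Sum>l\<le>s. c l * mat_fun P i (f l)) = 0"
          by (metis to_fract_sum)
        then show ?thesis by (simp only: to_fract_eq_0_iff)
      qed (simp add: mat_fun_def)
      moreover have "\<exists>l\<le>s. c l \<noteq> 0"
      proof -
        obtain l where "l \<le> s" "w $ l \<noteq> 0"
          using w(1,2) by (metis (no_types, lifting) carrier_vecD eq_vecI index_zero_vec less_Suc_eq_le)
        then show ?thesis using c[of l] q by (metis atMost_iff mult_eq_0_iff to_fract_eq_0_iff)
      qed
      ultimately show ?thesis by blast
    qed
  qed
qed

text \<open>A larger rank would supply \<open>s + 1\<close> distinct independent columns,
  contradicting their polynomial relation read over the rational functions.\<close>

lemma normal_rank_le_of_cols_dep: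
  assumes "cols_dep s (mat_fun P)"
  shows "normal_rank P \<le> s"
proof (rule ccontr)
  let ?K = "map_mat to_fract P" and ?n = "dim_row P"
  interpret vec_space "TYPE(complex poly fract)" ?n .
  have K: "?K \<in> carrier_mat ?n (dim_col P)" by simp
  assume "\<not> normal_rank P \<le> s"
  then have large: "Suc s \<le> rank ?K" by (simp add: normal_rank_def)
  obtain S where S: "maximal S (\<lambda>T. T \<subseteq> set (cols ?K) \<and> lin_indpt T)"
    using maximal_exists[of "(\<lambda>T. T \<subseteq> set (cols ?K) \<and> lin_indpt T)" "card (set (cols ?K))" "{}"]
    by (meson List.finite_set card_mono empty_iff empty_subsetI finite_lin_indpt2 rev_finite_subset)
  then have "Suc s \<le> card S" using rank_card_indpt[OF K] large by simp
  then obtain T where T: "T \<subseteq> S" "card T = Suc s" "finite T"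
    by (rule obtain_subset_with_card_n)
  have indpt: "lin_indpt T" and TK: "T \<subseteq> set (cols ?K)"
    using S T(1) subset_li_is_li by (auto simp: maximal_def)
  obtain vs where vs: "set vs = T" "distinct vs"
    using finite_distinct_list[OF T(3)] by blast
  have len: "length vs = Suc s" using vs T(2) distinct_card by metis
  have "\<exists>j < dim_col P. vs ! l = col ?K j" if "l \<le> s" for l
  proof -
    have "vs ! l \<in> set (cols ?K)" using that len vs(1) TK nth_mem[of l vs] by auto
    then show ?thesis by (auto simp: cols_def)
  qed
  then obtain f where f: "\<And>l. l \<le> s \<Longrightarrow> f l < dim_col P \<and> vs ! l = col ?K (f l)" by metis
  obtain c where c: "\<exists>l\<le>s. c l \<noteq> 0" "\<And>i. (\<Sum>l\<le>s. c l * mat_fun P i (f l)) = 0"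
    using spec[OF assms[unfolded cols_dep_def], of f] by blast
  define M where "M = mat_of_cols ?n vs"
  define w where "w = vec (Suc s) (\<lambda>l. to_fract (c l))"
  have M: "M \<in> carrier_mat ?n (Suc s)" using len by (auto simp: M_def)
  have "set vs \<subseteq> carrier_vec ?n" using vs TK by (auto simp: cols_def)
  then have cols: "cols M = vs" unfolding M_def by (rule cols_mat_of_cols)
  have "w \<noteq> 0\<^sub>v (Suc s)"
  proof
    assume "w = 0\<^sub>v (Suc s)"
    then have wl: "w $ l = 0\<^sub>v (Suc s) $ l" for l by simp
    have "to_fract (c l) = 0" if "l \<le> s" for l
      using wl[of l] that by (simp add: w_def)
    then show False using c(1) by auto
  qed
  moreover have "M *\<^sub>v w = 0\<^sub>v ?n"
  proof (rule eq_vecI)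
    fix i assume "i < dim_vec (0\<^sub>v ?n :: complex poly fract vec)"
    then have i: "i < ?n" by simp
    have "(M *\<^sub>v w) $ i = (\<Sum>l\<in>{0..<Suc s}. M $$ (i, l) * w $ l)"
      using i M by (simp add: w_def scalar_prod_def del: sum.op_ivl_Suc)
    also have "\<dots> = (\<Sum>l\<le>s. to_fract (c l * mat_fun P i (f l)))"
      using i f len by (intro sum.cong) (auto simp: M_def w_def mat_of_cols_def mat_fun_def mult.commute)
    also have "\<dots> = to_fract (\<Sum>l\<le>s. c l * mat_fun P i (f l))" by simp
    finally show "(M *\<^sub>v w) $ i = 0\<^sub>v ?n $ i" using c(2) i by simp
  qed (use M in auto)
  ultimately have "lin_dep (set (cols M))"
    using lin_depI[OF M, of w] cols vs(2) by (simp add: w_def)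
  then show False using indpt cols vs(1) by simp
qed

section \<open>Limits\<close>

lemma tendsto_coeff_mult:
  fixes p q :: "'b \<Rightarrow> complex poly"
  assumes "\<And>k. ((\<lambda>n. coeff (p n) k) \<longlongrightarrow> coeff p' k) F" "\<And>k. ((\<lambda>n. coeff (q n) k) \<longlongrightarrow> coeff q' k) F"
  shows "((\<lambda>n. coeff (p n * q n) k) \<longlongrightarrow> coeff (p' * q') k) F"
  unfolding coeff_mult by (intro tendsto_intros assms)

text \<open>Elimination is polynomial in the coefficients, so it commutes with limits, and a pivot
  that is nonzero in the limit is nonzero for almost all \<open>n\<close>.\<close>

lemma cols_dep_limit:
  fixes X :: "nat \<Rightarrow> nat \<Rightarrow> nat \<Rightarrow> complex poly"
  assumes "\<And>n i j. X n i j = - X n j i" and "\<And>n. cols_dep (2 * r) (X n)"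
    and "\<And>i j k. (\<lambda>n. coeff (X n i j) k) \<longlonglongrightarrow> coeff (P i j) k"
  shows "cols_dep (2 * r) P"
  using assms
proof (induction r arbitrary: X P)
  case 0
  have "X n i j = 0" for n i j using "0.prems"(2)[of n] by (simp add: cols_dep_0)
  then have "coeff (P i j) k = 0" for i j k
    using "0.prems"(3)[of i j k] by (simp add: LIMSEQ_const_iff)
  then have "P i j = 0" for i j by (simp add: poly_eq_iff)
  then show ?case unfolding cols_dep_def by (intro allI exI[of _ "\<lambda>_. 1"]) auto
next
  case (Suc r)
  note skewX = Suc.prems(1)
  have skewP: "P i j = - P j i" for i j
  proof (rule poly_eqI)
    fix k
    have "(\<lambda>n. coeff (- X n j i) k) \<longlonglongrightarrow> coeff (P i j) k"
      using Suc.prems(3)[of i j k] unfolding skewX[of _ i j] .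
    moreover have "(\<lambda>n. coeff (- X n j i) k) \<longlonglongrightarrow> coeff (- P j i) k"
      unfolding coeff_minus by (intro tendsto_minus Suc.prems(3))
    ultimately show "coeff (P i j) k = coeff (- P j i) k" by (rule LIMSEQ_unique)
  qed
  show ?case
  proof (cases "\<forall>i j. P i j = 0")
    case True
    then show ?thesis unfolding cols_dep_def by (intro allI exI[of _ "\<lambda>_. 1"]) auto
  next
    case False
    then obtain g h where gh: "P g h \<noteq> 0" by blast
    then obtain k where k: "coeff (P g h) k \<noteq> 0" by (auto simp: poly_eq_iff)
    have "\<forall>\<^sub>F n in sequentially. coeff (X n g h) k \<noteq> 0"
      by (rule tendsto_imp_eventually_ne[OF Suc.prems(3) k])
    then obtain N where N: "\<And>n. N \<le> n \<Longrightarrow> coeff (X n g h) k \<noteq> 0"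
      by (auto simp: eventually_sequentially)
    \<comment> \<open>The shift by \<open>N\<close> discards the terms whose pivot may vanish, since
      the induction hypothesis needs the rank bound for every \<open>n\<close>.\<close>
    define Y where "Y n = skew_elim g h (X (n + N))" for n
    have "cols_dep (2 * r) (skew_elim g h P)"
    proof (rule Suc.IH)
      show "Y n i j = - Y n j i" for n i j
        unfolding Y_def by (rule skew_elim_skew) (rule skewX)
      show "cols_dep (2 * r) (Y n)" for n
        unfolding Y_def
      proof (rule cols_dep_skew_elim)
        show "X (n + N) i j = - X (n + N) j i" for i j by (rule skewX)
        show "X (n + N) g h \<noteq> 0" using N[of "n + N"] by auto
        show "cols_dep (Suc (Suc (2 * r))) (X (n + N))" using Suc.prems(2)[of "n + N"] by simp
      qed
      have lim: "(\<lambda>n. coeff (X (n + N) i j) k) \<longlonglongrightarrow> coeff (P i j) k" for i j k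
        by (rule LIMSEQ_ignore_initial_segment) (rule Suc.prems(3))
      show "(\<lambda>n. coeff (Y n i j) k) \<longlonglongrightarrow> coeff (skew_elim g h P i j) k" for i j k
        unfolding Y_def skew_elim_def coeff_diff by (intro tendsto_diff tendsto_coeff_mult lim)
    qed
    \<comment> \<open>The bound is lifted from the complement back to \<open>P\<close> by way of
      bivectors: \<open>r\<close> for the complement and one for the pivot rows.\<close>
    then have "\<exists>q u v. q \<noteq> 0 \<and> (\<forall>i j. q * skew_elim g h P i j = wedge_sum {..<r} u v i j)"
      by (rule wedge_sum_of_cols_dep[rotated]) (rule skew_elim_skew, rule skewP)
    then obtain q u v where "q \<noteq> 0" "\<And>i j. q * skew_elim g h P i j = wedge_sum {..<r} u v i j" by blast
    then have "\<exists>q u v. q \<noteq> 0 \<and> (\<forall>i j. q * P i j = wedge_sum {..<Suc r} u v i j)"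
      by (rule wedge_sum_skew_elim[of P, OF gh])
    then show ?thesis using cols_dep_wedge_sum by blast
  qed
qed

section \<open>Balancing the degrees of a pair\<close>

lemma unbalanced_pair_step:
  fixes u v :: "nat \<Rightarrow> complex poly"
  assumes "\<And>i. degree (u i) \<le> p" "\<And>i. degree (v i) \<le> Suc (p + n)" and "\<epsilon> > 0"
  shows "\<exists>u' v'. (\<forall>i. degree (u' i) \<le> Suc p \<and> degree (v' i) \<le> p + n) \<and>
    (\<forall>i<m. \<forall>j<m. \<forall>k\<le>d. cmod (coeff (u' i * v' j - v' i * u' j) k - coeff (u i * v j - v i * u j) k) < \<epsilon>)"
proof -
  define c where "c i = coeff (v i) (Suc (p + n))" for i
  define E where "E i j = monom (c i) (Suc p) * v j - v i * monom (c j) (Suc p)" for i j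
  \<comment> \<open>\<open>E\<close> is independent of \<open>\<delta>\<close>, so its finitely many
    relevant coefficients are bounded before \<open>\<delta>\<close> is chosen.\<close>
  obtain B where B: "\<And>i j k. i < m \<Longrightarrow> j < m \<Longrightarrow> k \<le> d \<Longrightarrow> cmod (coeff (E i j) k) \<le> B"
  proof -
    have "bdd_above ((\<lambda>(i, j, k). cmod (coeff (E i j) k)) ` ({..<m} \<times> {..<m} \<times> {..d}))"
      by (intro bdd_above_finite finite_imageI finite_cartesian_product) auto
    then obtain B where "\<forall>x\<in>{..<m} \<times> {..<m} \<times> {..d}. (case x of (i, j, k) \<Rightarrow> cmod (coeff (E i j) k)) \<le> B"
      unfolding bdd_above_def by auto
    then show thesis by (intro that[of B]) auto
  qed
  define \<delta> where "\<delta> = \<epsilon> / (1 + \<bar>B\<bar>)"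
  have \<delta>: "\<delta> > 0" "\<delta> * \<bar>B\<bar> < \<epsilon>" using assms(3) by (auto simp: \<delta>_def field_simps)
  define u' where "u' i = u i + smult \<delta> (monom (c i) (Suc p))" for i
  define v' where "v' i = v i - monom (1 / \<delta>) n * u' i" for i
  have "degree (u' i) \<le> Suc p" for i
    unfolding u'_def using assms(1)[of i]
    by (intro degree_add_le order_trans[OF degree_smult_le] degree_monom_le) simp
  moreover have "degree (v' i) \<le> p + n" for i
  proof -
    \<comment> \<open>The factors \<open>\<delta>\<close> and \<open>1 / \<delta>\<close> cancel, so
      exactly the top term of \<open>v\<close> is removed.\<close>
    have v': "v' i = (v i - monom (c i) (Suc (p + n))) - monom (1 / \<delta>) n * u i"
      using \<delta>(1) by (simp add: v'_def u'_def algebra_simps mult_monom smult_monom)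
    show ?thesis unfolding v'
    proof (rule degree_diff_le)
      show "degree (v i - monom (c i) (Suc (p + n))) \<le> p + n"
      proof (rule degree_le, intro allI impI)
        fix k assume "p + n < k"
        then show "coeff (v i - monom (c i) (Suc (p + n))) k = 0"
          using assms(2)[of i] by (cases "k = Suc (p + n)") (auto simp: c_def intro!: coeff_eq_0)
      qed
      show "degree (monom (1 / \<delta>) n * u i) \<le> p + n"
        using degree_mult_le[of "monom (1 / \<delta>) n" "u i"] degree_monom_le[of "1 / complex_of_real \<delta>" n] assms(1)[of i]
        by simp
    qed
  qed
  moreover have "cmod (coeff (u' i * v' j - v' i * u' j) k - coeff (u i * v j - v i * u j) k) < \<epsilon>"
    if "i < m" "j < m" "k \<le> d" for i j k
  proof -
    have "u' i * v' j - v' i * u' j = u' i * v j - v i * u' j"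
      by (simp add: v'_def algebra_simps)
    also have "\<dots> = (u i * v j - v i * u j) + smult \<delta> (E i j)"
      by (simp add: u'_def E_def algebra_simps smult_diff_right)
    finally have "cmod (coeff (u' i * v' j - v' i * u' j) k - coeff (u i * v j - v i * u j) k)
        = \<delta> * cmod (coeff (E i j) k)"
      using \<delta>(1) by (simp add: norm_mult)
    also have "\<dots> \<le> \<delta> * \<bar>B\<bar>"
      using B[OF that] \<delta>(1) by (intro mult_left_mono) auto
    finally show ?thesis using \<delta>(2) by simp
  qed
  ultimately show ?thesis by blast
qed

text \<open>Each step moves one degree from \<open>v\<close> to \<open>u\<close> and spends half of
  the remaining tolerance.\<close>

lemma unbalanced_pair_approx:
  fixes u v :: "nat \<Rightarrow> complex poly"
  assumes "a \<le> b" "s \<le> a" "\<And>i. degree (u i) \<le> a - s" "\<And>i. degree (v i) \<le> b + s" and "\<epsilon> > 0"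
  shows "\<exists>u' v'. (\<forall>i. degree (u' i) \<le> a \<and> degree (v' i) \<le> b) \<and>
    (\<forall>i<m. \<forall>j<m. \<forall>k\<le>d. cmod (coeff (u' i * v' j - v' i * u' j) k - coeff (u i * v j - v i * u j) k) < \<epsilon>)"
  using assms(2-)
proof (induction s arbitrary: u v \<epsilon>)
  case 0
  then show ?case by (intro exI[of _ u] exI[of _ v]) simp
next
  case (Suc s)
  have dv: "b + Suc s = Suc ((a - Suc s) + (b + s - (a - Suc s)))"
    using assms(1) Suc.prems(1) by simp
  have \<epsilon>2: "\<epsilon> / 2 > 0" using Suc.prems(4) by simp
  obtain u1 v1 where 1: "\<And>i. degree (u1 i) \<le> Suc (a - Suc s)" "\<And>i. degree (v1 i) \<le> (a - Suc s) + (b + s - (a - Suc s))"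
    "\<And>i j k. i < m \<Longrightarrow> j < m \<Longrightarrow> k \<le> d \<Longrightarrow>
      cmod (coeff (u1 i * v1 j - v1 i * u1 j) k - coeff (u i * v j - v i * u j) k) < \<epsilon> / 2"
    using unbalanced_pair_step[of u _ v, OF Suc.prems(2) Suc.prems(3)[unfolded dv] \<epsilon>2, of m d] by blast
  have le: "s \<le> a" "degree (u1 i) \<le> a - s" "degree (v1 i) \<le> b + s" for i
    using Suc.prems(1) 1(1,2)[of i] assms(1) by auto
  obtain u2 v2 where 2: "\<And>i. degree (u2 i) \<le> a \<and> degree (v2 i) \<le> b"
    "\<And>i j k. i < m \<Longrightarrow> j < m \<Longrightarrow> k \<le> d \<Longrightarrow>
      cmod (coeff (u2 i * v2 j - v2 i * u2 j) k - coeff (u1 i * v1 j - v1 i * u1 j) k) < \<epsilon> / 2"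
    using Suc.IH[of u1 v1, OF le \<epsilon>2] by blast
  have "cmod (coeff (u2 i * v2 j - v2 i * u2 j) k - coeff (u i * v j - v i * u j) k) < \<epsilon>"
    if "i < m" "j < m" "k \<le> d" for i j k
    using norm_diff_triangle_less[OF 2(2)[OF that] 1(3)[OF that]] by simp
  then show ?case using 2(1) by blast
qed

text \<open>If \<open>q\<close> is at least \<open>b\<close>, then \<open>q - b\<close> steps
  suffice. Otherwise \<open>b \<le> Suc a\<close> forces \<open>p \<ge> b\<close>, and the pair of
  \<open>v\<close> and \<open>- u\<close>, with the same bivector, is used instead.\<close>

lemma balanced_pair_approx:
  fixes u v :: "nat \<Rightarrow> complex poly"
  assumes "a \<le> b" "b \<le> Suc a" "p + q = a + b" "\<And>i. degree (u i) \<le> p" "\<And>i. degree (v i) \<le> q" and "\<epsilon> > 0"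
  shows "\<exists>u' v'. (\<forall>i. degree (u' i) \<le> a \<and> degree (v' i) \<le> b) \<and>
    (\<forall>i<m. \<forall>j<m. \<forall>k\<le>d. cmod (coeff (u' i * v' j - v' i * u' j) k - coeff (u i * v j - v i * u j) k) < \<epsilon>)"
proof (cases "b \<le> q")
  case True
  then have le: "q - b \<le> a" "p \<le> a - (q - b)" "q \<le> b + (q - b)" using assms(3) by auto
  have "degree (u i) \<le> a - (q - b)" "degree (v i) \<le> b + (q - b)" for i
    using order_trans[OF assms(4) le(2)] order_trans[OF assms(5) le(3)] .
  then show ?thesis
    by (rule unbalanced_pair_approx[OF assms(1) le(1) _ _ assms(6)])
next
  case False
  then have le: "p - b \<le> a" "q \<le> a - (p - b)" "p \<le> b + (p - b)" using assms(2,3) by auto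
  have "degree (v i) \<le> a - (p - b)" "degree (- u i) \<le> b + (p - b)" for i
    using order_trans[OF assms(5) le(2)] order_trans[OF assms(4) le(3)] by simp_all
  then have "\<exists>u' v'. (\<forall>i. degree (u' i) \<le> a \<and> degree (v' i) \<le> b) \<and>
      (\<forall>i<m. \<forall>j<m. \<forall>k\<le>d. cmod (coeff (u' i * v' j - v' i * u' j) k - coeff (v i * - u j - - u i * v j) k) < \<epsilon>)"
    by (rule unbalanced_pair_approx[OF assms(1) le(1) _ _ assms(6)])
  moreover have "v i * - u j - - u i * v j = u i * v j - v i * u j" for i j
    by (simp add: algebra_simps)
  ultimately show ?thesis by (simp only:)
qed

lemma balanced_approx:
  fixes u v :: "nat \<Rightarrow> nat \<Rightarrow> complex poly"
  assumes "a \<le> b" "b \<le> Suc a" "\<And>l. l < r \<Longrightarrow> p l + q l = a + b"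
    and "\<And>l i. l < r \<Longrightarrow> degree (u l i) \<le> p l \<and> degree (v l i) \<le> q l" and "\<epsilon> > 0"
  shows "\<exists>u' v'. (\<forall>l<r. \<forall>i. degree (u' l i) \<le> a \<and> degree (v' l i) \<le> b) \<and>
    (\<forall>i<m. \<forall>j<m. \<forall>k\<le>d. cmod (coeff (wedge_sum {..<r} u' v' i j) k - coeff (wedge_sum {..<r} u v i j) k) < \<epsilon>)"
proof -
  define \<eta> where "\<eta> = \<epsilon> / (1 + real r)"
  have \<eta>: "\<eta> > 0" "real r * \<eta> < \<epsilon>" using assms(5) by (auto simp: \<eta>_def field_simps)
  define Q where "Q l u' v' \<longleftrightarrow> (\<forall>i. degree (u' i) \<le> a \<and> degree (v' i) \<le> b) \<and>
    (\<forall>i<m. \<forall>j<m. \<forall>k\<le>d.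
      cmod (coeff (u' i * v' j - v' i * u' j) k - coeff (u l i * v l j - v l i * u l j) k) < \<eta>)"
    for l and u' v' :: "nat \<Rightarrow> complex poly"
  have "\<exists>u' v'. Q l u' v'" if "l < r" for l
    unfolding Q_def
    by (rule balanced_pair_approx[OF assms(1,2) assms(3)[OF that] _ _ \<eta>(1)]) (use assms(4)[OF that] in auto)
  then obtain u' v' where "\<And>l. l < r \<Longrightarrow> Q l (u' l) (v' l)"
    by metis
  then have *: "\<And>l i. l < r \<Longrightarrow> degree (u' l i) \<le> a \<and> degree (v' l i) \<le> b"
    "\<And>l i j k. l < r \<Longrightarrow> i < m \<Longrightarrow> j < m \<Longrightarrow> k \<le> d \<Longrightarrow>
      cmod (coeff (u' l i * v' l j - v' l i * u' l j) k - coeff (u l i * v l j - v l i * u l j) k) < \<eta>"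
    unfolding Q_def by blast+
  have "cmod (coeff (wedge_sum {..<r} u' v' i j) k - coeff (wedge_sum {..<r} u v i j) k) < \<epsilon>"
    if "i < m" "j < m" "k \<le> d" for i j k
  proof -
    have "cmod (coeff (wedge_sum {..<r} u' v' i j) k - coeff (wedge_sum {..<r} u v i j) k) \<le>
      (\<Sum>l<r. cmod (coeff (u' l i * v' l j - v' l i * u' l j) k - coeff (u l i * v l j - v l i * u l j) k))"
      unfolding wedge_sum_def coeff_sum sum_subtractf[symmetric] by (rule norm_sum)
    also have "\<dots> \<le> (\<Sum>l<r. \<eta>)"
      using *(2)[OF _ that] by (intro sum_mono less_imp_le) auto
    finally show ?thesis using \<eta>(2) by simp
  qed
  then show ?thesis using *(1) by blast
qed

section \<open>Matrices as functions, and coefficientwise control of the distance\<close>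

lemma mat_fun_index: "P \<in> carrier_mat n m \<Longrightarrow> i < n \<Longrightarrow> j < m \<Longrightarrow> mat_fun P i j = P $$ (i, j)"
  by (simp add: mat_fun_def)

lemma POL_ss_skew:
  assumes "P \<in> POL_ss d m"
  shows "mat_fun P i j = - mat_fun P j i"
proof (cases "i < m \<and> j < m")
  case True
  have P: "P \<in> carrier_mat m m" and deg: "degree (P $$ (i, j)) \<le> d" "degree (P $$ (j, i)) \<le> d"
    using assms True by (auto simp: POL_ss_def POL_def)
  have "P $$ (i, j) = - P $$ (j, i)"
  proof (rule poly_eqI)
    fix k
    show "coeff (P $$ (i, j)) k = coeff (- P $$ (j, i)) k"
    proof (cases "k \<le> d")
      case k: True
      then have "transpose_mat (coeff_mat P k) = - coeff_mat P k"
        using assms by (auto simp: POL_ss_def)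
      then have "transpose_mat (coeff_mat P k) $$ (j, i) = (- coeff_mat P k) $$ (j, i)" by simp
      then show ?thesis using True P by (simp add: coeff_mat_def)
    next
      case False
      then show ?thesis using deg by (simp add: coeff_eq_0)
    qed
  qed
  then show ?thesis using True P by (simp add: mat_fun_def)
next
  case False
  then show ?thesis using assms by (auto simp: mat_fun_def POL_ss_def POL_def)
qed

lemma coeff_diff_le_pol_dist:
  assumes "P \<in> carrier_mat m m" "Q \<in> carrier_mat m m" "i < m" "j < m" "k \<le> d"
  shows "cmod (coeff (P $$ (i, j)) k - coeff (Q $$ (i, j)) k) \<le> pol_dist d m P Q"
proof -
  have "(\<lambda>(k, i, j). cmod (coeff_mat P k $$ (i, j) - coeff_mat Q k $$ (i, j))) (k, i, j) \<le> pol_dist d m P Q"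
    unfolding pol_dist_L2_set by (rule member_le_L2_set) (use assms in auto)
  then show ?thesis using assms by (simp add: coeff_mat_def)
qed

lemma pol_dist_le:
  assumes "P \<in> carrier_mat m m" "Q \<in> carrier_mat m m"
    and "\<And>i j k. i < m \<Longrightarrow> j < m \<Longrightarrow> k \<le> d \<Longrightarrow> cmod (coeff (P $$ (i, j)) k - coeff (Q $$ (i, j)) k) \<le> \<epsilon>"
  shows "pol_dist d m P Q \<le> real (Suc d * m * m) * \<epsilon>"
proof -
  have "pol_dist d m P Q \<le> (\<Sum>(k, i, j)\<in>{..d} \<times> {..<m} \<times> {..<m}.
      cmod (coeff_mat P k $$ (i, j) - coeff_mat Q k $$ (i, j)))"
    unfolding pol_dist_L2_set by (rule L2_set_le_sum) auto
  also have "\<dots> \<le> (\<Sum>x\<in>{..d} \<times> {..<m} \<times> {..<m}. \<epsilon>)"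
    using assms by (intro sum_mono) (auto simp: coeff_mat_def)
  finally show ?thesis by (simp add: algebra_simps)
qed

lemma mat_fun_wedge:
  assumes "U \<in> carrier_mat m r" "V \<in> carrier_mat m r"
  shows "mat_fun (U * transpose_mat V - V * transpose_mat U) =
    wedge_sum {..<r} (\<lambda>l i. mat_fun U i l) (\<lambda>l i. mat_fun V i l)"
proof (intro ext)
  fix i j
  show "mat_fun (U * transpose_mat V - V * transpose_mat U) i j =
    wedge_sum {..<r} (\<lambda>l i. mat_fun U i l) (\<lambda>l i. mat_fun V i l) i j"
  proof (cases "i < m \<and> j < m")
    case True
    then show ?thesis
      using assms by (simp add: mat_fun_def wedge_sum_def scalar_prod_def sum_subtractf lessThan_atLeast0)
  next
    case False
    then show ?thesis using assms by (auto simp: mat_fun_def wedge_sum_def)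
  qed
qed

text \<open>An exact representation that lacks only the balance needed for \<open>G_ss\<close>: the
  two bounds of each pair add up to \<open>d\<close> but may be split unevenly.\<close>

lemma POL_ss_rank_wedge_sum:
  assumes "P \<in> POL_ss_rank d (2 * r) m"
  shows "\<exists>u v a b. mat_fun P = wedge_sum {..<r} u v \<and>
    (\<forall>l\<in>{..<r}. a l + b l = d \<and> (\<forall>i. degree (u l i) \<le> a l \<and> degree (v l i) \<le> b l))"
proof -
  have Pss: "P \<in> POL_ss d m" and rk: "normal_rank P \<le> 2 * r"
    using assms by (auto simp: POL_ss_rank_def)
  then have P: "P \<in> carrier_mat m m" and deg: "\<And>i j. i < m \<Longrightarrow> j < m \<Longrightarrow> degree (P $$ (i, j)) \<le> d"
    by (auto simp: POL_ss_def POL_def)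
  have "\<exists>q u v. q \<noteq> 0 \<and> (\<forall>i j. q * mat_fun P i j = wedge_sum {..<r} u v i j)"
    by (rule wedge_sum_of_cols_dep[OF POL_ss_skew[OF Pss] cols_dep_of_normal_rank[OF rk]])
  then obtain q u1 v1 where "q \<noteq> 0" "\<And>i j. q * mat_fun P i j = wedge_sum {..<r} u1 v1 i j" by blast
  then have "\<exists>u v. mat_fun P = wedge_sum {..<r} u v"
    by (rule wedge_sum_cancel_factor[OF finite_lessThan])
  then obtain u v where uv: "mat_fun P = wedge_sum {..<r} u v" by blast
  \<comment> \<open>Cutting off the coordinates from \<open>m\<close> on makes the degrees bounded
    uniformly in \<open>i\<close>; the sum is unchanged because \<open>mat_fun P\<close> is zero
    there.\<close>
  let ?u = "\<lambda>l i. if i < m then u l i else 0" and ?v = "\<lambda>l i. if i < m then v l i else 0"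
  have eq: "wedge_sum {..<r} ?u ?v = mat_fun P"
  proof (intro ext)
    fix i j
    show "wedge_sum {..<r} ?u ?v i j = mat_fun P i j"
    proof (cases "i < m \<and> j < m")
      case True
      then show ?thesis by (simp add: uv wedge_sum_def)
    next
      case False
      then show ?thesis using P by (auto simp: mat_fun_def wedge_sum_def)
    qed
  qed
  \<comment> \<open>The summand \<open>d\<close> keeps \<open>2 * N - d\<close> an exact
    difference.\<close>
  define N where "N = d + (\<Sum>l<r. \<Sum>i<m. degree (u l i) + degree (v l i))"
  have N: "degree (?u l i) \<le> N \<and> degree (?v l i) \<le> N" if "l \<in> {..<r}" for l i
  proof (cases "i < m")
    case True
    have "degree (u l i) + degree (v l i) \<le> (\<Sum>i<m. degree (u l i) + degree (v l i))"
      using True by (intro member_le_sum) auto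
    also have "\<dots> \<le> (\<Sum>l<r. \<Sum>i<m. degree (u l i) + degree (v l i))"
      using that by (intro member_le_sum[of l "{..<r}" "\<lambda>l. \<Sum>i<m. degree (u l i) + degree (v l i)"]) auto
    finally show ?thesis using True by (simp add: N_def)
  qed simp
  have "\<exists>u' v' a' b'. wedge_sum {..<r} u' v' = wedge_sum {..<r} ?u ?v \<and>
    (\<forall>l\<in>{..<r}. a' l + b' l = d \<and> (\<forall>i. degree (u' l i) \<le> a' l \<and> degree (v' l i) \<le> b' l))"
  proof (rule degree_normalization[where a = "\<lambda>_. N" and b = "\<lambda>_. N" and n = "2 * N - d"])
    show "N + N = d + (2 * N - d)" by (simp add: N_def)
    show "degree (wedge_sum {..<r} ?u ?v i j) \<le> d" for i j
      unfolding eq using deg P by (simp add: mat_fun_def)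
  qed (use N in auto)
  then show ?thesis unfolding eq by metis
qed

theorem theorem3p1:
  fixes m r d :: nat
  assumes "d \<ge> 1" and "2 \<le> 2 * r" and "2 * r \<le> m - 1"
  shows "POL_ss_topology d m closure_of G_ss d r m = POL_ss_rank d (2 * r) m"
proof -
  interpret Metric_space "POL_ss d m" "pol_dist d m" by (rule Metric_space_POL_ss)
  have carrier: "P \<in> carrier_mat m m" if "P \<in> POL_ss d m" for P
    using that by (simp add: POL_ss_def POL_def)
  have degree: "degree (P $$ (i, j)) \<le> d" if "P \<in> POL_ss d m" "i < m" "j < m" for P i j
    using that by (simp add: POL_ss_def POL_def)
  show ?thesis
    unfolding POL_ss_topology_def metric_closure_of
  proof (intro equalityI subsetI)
    fix P assume "P \<in> {x \<in> POL_ss d m. \<forall>e>0. \<exists>y\<in>G_ss d r m. y \<in> mball x e}"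
    then have P: "P \<in> POL_ss d m" and near: "\<And>e. e > 0 \<Longrightarrow> \<exists>Q\<in>G_ss d r m. pol_dist d m P Q < e"
      by auto
    \<comment> \<open>A sequence in \<open>G_ss\<close> tending to \<open>P\<close> reduces this
      inclusion to \<open>cols_dep_limit\<close>.\<close>
    have "\<forall>n. \<exists>Q\<in>G_ss d r m. pol_dist d m P Q < inverse (real (Suc n))"
      by (intro allI near) simp
    then obtain Q where Q: "\<And>n. Q n \<in> G_ss d r m" "\<And>n. pol_dist d m P (Q n) < inverse (real (Suc n))"
      by metis
    have Qss: "Q n \<in> POL_ss d m" for n using Q(1) G_ss_subset_POL_ss by blast
    have "cols_dep (2 * r) (mat_fun P)"
    proof (rule cols_dep_limit)
      show "mat_fun (Q n) i j = - mat_fun (Q n) j i" for n i j by (rule POL_ss_skew[OF Qss])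
      show "cols_dep (2 * r) (mat_fun (Q n))" for n
      proof -
        obtain U V where "Q n = U * transpose_mat V - V * transpose_mat U" "U \<in> carrier_mat m r" "V \<in> carrier_mat m r"
          using Q(1)[of n] by (auto simp: G_ss_def POL_def)
        then have "1 * mat_fun (Q n) i j = wedge_sum {..<r} (\<lambda>l i. mat_fun U i l) (\<lambda>l i. mat_fun V i l) i j" for i j
          by (simp add: mat_fun_wedge)
        then show ?thesis by (rule cols_dep_wedge_sum[rotated]) simp
      qed
      show "(\<lambda>n. coeff (mat_fun (Q n) i j) k) \<longlonglongrightarrow> coeff (mat_fun P i j) k" for i j k
      proof (cases "i < m \<and> j < m \<and> k \<le> d")
        case True
        have "cmod (coeff (mat_fun (Q n) i j) k - coeff (mat_fun P i j) k) \<le> inverse (real (Suc n))" for n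
          using coeff_diff_le_pol_dist[OF carrier[OF P] carrier[OF Qss], of i j k d n] Q(2)[of n] True
            carrier[OF P] carrier[OF Qss, of n] by (simp add: mat_fun_def norm_minus_commute)
        then show ?thesis
          by (intro LIM_zero_cancel[OF Lim_null_comparison[OF _ LIMSEQ_inverse_real_of_nat]] always_eventually) auto
      next
        case False
        have "coeff (mat_fun R i j) k = 0" if "R \<in> POL_ss d m" for R
        proof (cases "i < m \<and> j < m")
          case True
          then have "degree (R $$ (i, j)) < k" using degree[OF that, of i j] False by simp
          then show ?thesis by (simp add: mat_fun_def coeff_eq_0)
        qed (use carrier[OF that] in \<open>auto simp: mat_fun_def\<close>)
        then show ?thesis using P Qss by simp
      qed
    qed
    then show "P \<in> POL_ss_rank d (2 * r) m"
      using P normal_rank_le_of_cols_dep by (simp add: POL_ss_rank_def)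
  next
    fix P assume P: "P \<in> POL_ss_rank d (2 * r) m"
    then have Pss: "P \<in> POL_ss d m" by (simp add: POL_ss_rank_def)
    \<comment> \<open>These are the floor and ceiling of half of \<open>d\<close>; they differ by at
      most one, as \<open>balanced_approx\<close> requires.\<close>
    let ?a = "d div 2" and ?b = "d - d div 2"
    have half: "nat \<lfloor>real d / 2\<rfloor> = ?a" "nat \<lceil>real d / 2\<rceil> = ?b"
      by linarith+
    obtain u v a b where uv: "mat_fun P = wedge_sum {..<r} u v"
      and uv_deg: "\<forall>l\<in>{..<r}. a l + b l = d \<and> (\<forall>i. degree (u l i) \<le> a l \<and> degree (v l i) \<le> b l)"
      using POL_ss_rank_wedge_sum[OF P] by blast
    have ab: "a l + b l = ?a + ?b" if "l < r" for l
      using uv_deg that by simp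
    have deg: "degree (u l i) \<le> a l \<and> degree (v l i) \<le> b l" if "l < r" for l i
      using uv_deg that by simp
    have "\<exists>Q\<in>G_ss d r m. pol_dist d m P Q < e" if "e > 0" for e
    proof -
      \<comment> \<open>The denominator exceeds the number of coefficients by one, which makes the
        final estimate strict.\<close>
      define \<epsilon> where "\<epsilon> = e / (1 + real (Suc d * m * m))"
      have \<epsilon>: "\<epsilon> > 0" "real (Suc d * m * m) * \<epsilon> < e"
        using that by (auto simp: \<epsilon>_def field_simps add_pos_nonneg simp del: of_nat_mult of_nat_Suc)
      have le: "?a \<le> ?b" "?b \<le> Suc ?a" by linarith+
      obtain u' v' where deg': "\<And>l i. l < r \<Longrightarrow> degree (u' l i) \<le> ?a \<and> degree (v' l i) \<le> ?b"
        and close: "\<And>i j k. i < m \<Longrightarrow> j < m \<Longrightarrow> k \<le> d \<Longrightarrow>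
          cmod (coeff (wedge_sum {..<r} u' v' i j) k - coeff (wedge_sum {..<r} u v i j) k) < \<epsilon>"
        using balanced_approx[of ?a ?b r a b u v \<epsilon> m d, OF le ab deg \<epsilon>(1)] by blast
      define U where "U = mat m r (\<lambda>(i, l). u' l i)"
      define V where "V = mat m r (\<lambda>(i, l). v' l i)"
      let ?Q = "U * transpose_mat V - V * transpose_mat U"
      have QG: "?Q \<in> G_ss d r m"
        unfolding G_ss_def half using deg' by (auto simp: U_def V_def POL_def intro!: exI)
      then have Qss: "?Q \<in> POL_ss d m" using G_ss_subset_POL_ss by blast
      have UV: "U \<in> carrier_mat m r" "V \<in> carrier_mat m r" by (auto simp: U_def V_def)
      have Qw: "mat_fun ?Q i j = wedge_sum {..<r} u' v' i j" if "i < m" "j < m" for i j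
        unfolding mat_fun_wedge[OF UV] using that by (simp add: wedge_sum_def mat_fun_def U_def V_def)
      have entry: "?Q $$ (i, j) = wedge_sum {..<r} u' v' i j"
          "P $$ (i, j) = wedge_sum {..<r} u v i j" if "i < m" "j < m" for i j
        using Qw[OF that] mat_fun_index[OF carrier[OF Qss] that] mat_fun_index[OF carrier[OF Pss] that] uv
        by metis+
      have "pol_dist d m P ?Q \<le> real (Suc d * m * m) * \<epsilon>"
        by (rule pol_dist_le[OF carrier[OF Pss] carrier[OF Qss]])
          (use close entry in \<open>simp add: less_imp_le norm_minus_commute\<close>)
      then show ?thesis using QG \<epsilon>(2) by (intro bexI[of _ ?Q]) auto
    qed
    then show "P \<in> {x \<in> POL_ss d m. \<forall>e>0. \<exists>y\<in>G_ss d r m. y \<in> mball x e}"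
      using Pss G_ss_subset_POL_ss by fastforce
  qed
qed

end
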